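(* Let $(X,\mu)$ be a Lebesgue space of infinite ($\sigma$-finite) measure and let $T:X\to X$ be a mixing automorphism of rank one. Then $T$ has minimal self-joinings (MSJ): every ergodic self-joining of $T$ equals an off-diagonal measure $\Delta^k$ for some $k\in\mathbb{Z}$.
   Context: An automorphism is an invertible measure-preserving transformation. Sets are measurable and identified modulo null sets. Rank one: $T$ is of rank one if there is a sequence $\xi_j$ of measurable partitions of $X$ of the form $\xi_j=\{E_j,TE_j,T^2E_j,\dots,T^{h_j}E_j,\tilde E_j\}$, where $\tilde E_j=X\setminus\bigsqcup_{i=0}^{h_j}T^iE_j$, such that $\xi_j$ converges to the partition into points, i.e. every set of finite measure can be approximated in measure, as $j\to\infty$, by $\xi_j$-measurable sets. Mixing (infinite measure): for any $\varepsilon>0$ and any sets $A,B$ of finite measure there is $N$ such that $\mu(T^kA\cap B)<\varepsilon$ for all $|k|>N$. Self-joining (of order 2): a $T\times T$-invariant measure $\nu$ on $X\times X$ with marginals equal to $\mu$, i.e. $\nu(A\times X)=\nu(X\times A)=\mu(A)$ for all measurable $A$. A self-joining is ergodic if it is not a nontrivial convex combination $a\nu_1+(1-a)\nu_2$, $0<a<1$, of two different self-joinings. Off-diagonal measures: $\Delta^k(A\times B)=\mu(T^kA\cap B)$, $k\in\mathbb{Z}$. *)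

theory Defs
  imports "HOL-Analysis.Analysis"
begin

section \<open>Lebesgue spaces\<close>

definition isomorphic_mod0 :: "'a measure \<Rightarrow> 'b measure \<Rightarrow> bool" where
  "isomorphic_mod0 M N \<longleftrightarrow>
    (\<exists>X\<^sub>0 Y\<^sub>0 f. space M - X\<^sub>0 \<in> null_sets M \<and> space N - Y\<^sub>0 \<in> null_sets N \<and>
       X\<^sub>0 \<in> sets M \<and> Y\<^sub>0 \<in> sets N \<and> bij_betw f X\<^sub>0 Y\<^sub>0 \<and>
       (\<forall>A\<subseteq>X\<^sub>0. A \<in> sets M \<longleftrightarrow> f ` A \<in> sets N) \<and>
       (\<forall>A\<in>sets M. A \<subseteq> X\<^sub>0 \<longrightarrow> emeasure N (f ` A) = emeasure M A))"

text \<open>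
  A sigma-finite Lebesgue space in the sense of Rokhlin: a complete measure space that is
  isomorphic modulo null sets to the completion of a sigma-finite Borel measure on the real
  line. Atoms are not excluded.
\<close>

definition lebesgue_space :: "'a measure \<Rightarrow> bool" where
  "lebesgue_space M \<longleftrightarrow> complete_measure M \<and>
    (\<exists>m :: real measure. sets m = sets borel \<and> sigma_finite_measure m \<and>
       isomorphic_mod0 M (completion m))"

section \<open>Automorphisms, mixing, rank one\<close>

definition automorphism :: "'a measure \<Rightarrow> ('a \<Rightarrow> 'a) \<Rightarrow> bool" where
  "automorphism M T \<longleftrightarrow> bij_betw T (space M) (space M) \<and>
     T \<in> measurable M M \<and> inv_into (space M) T \<in> measurable M M \<and> distr M M T = M"

definition int_iterate :: "'a measure \<Rightarrow> ('a \<Rightarrow> 'a) \<Rightarrow> int \<Rightarrow> 'a \<Rightarrow> 'a" where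
  "int_iterate M T k =
     (if 0 \<le> k then T ^^ nat k else inv_into (space M) T ^^ nat (- k))"

definition mixing_infinite :: "'a measure \<Rightarrow> ('a \<Rightarrow> 'a) \<Rightarrow> bool" where
  "mixing_infinite M T \<longleftrightarrow>
    (\<forall>\<epsilon>>0. \<forall>A\<in>sets M. \<forall>B\<in>sets M. emeasure M A < \<infinity> \<longrightarrow> emeasure M B < \<infinity> \<longrightarrow>
       (\<exists>N::int. \<forall>k. \<bar>k\<bar> > N \<longrightarrow> emeasure M (int_iterate M T k ` A \<inter> B) < \<epsilon>))"

definition tower_partition :: "'a measure \<Rightarrow> ('a \<Rightarrow> 'a) \<Rightarrow> 'a set \<Rightarrow> nat \<Rightarrow> 'a set set" where
  "tower_partition M T E h =
     insert (space M - (\<Union>i\<le>h. (T ^^ i) ` E)) ((\<lambda>i. (T ^^ i) ` E) ` {..h})"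

text \<open>A set is measurable with respect to a finite partition iff it is a union of some of its cells.\<close>

definition rank_one :: "'a measure \<Rightarrow> ('a \<Rightarrow> 'a) \<Rightarrow> bool" where
  "rank_one M T \<longleftrightarrow>
    (\<exists>(E :: nat \<Rightarrow> 'a set) (h :: nat \<Rightarrow> nat).
       (\<forall>j. E j \<in> sets M \<and> disjoint_family_on (\<lambda>i. (T ^^ i) ` E j) {..h j}) \<and>
       (\<forall>A\<in>sets M. emeasure M A < \<infinity> \<longrightarrow>
          (\<exists>B :: nat \<Rightarrow> 'a set.
             (\<forall>j. \<exists>S\<subseteq>tower_partition M T (E j) (h j). B j = \<Union>S) \<and>
             (\<lambda>j. emeasure M ((A - B j) \<union> (B j - A))) \<longlonglongrightarrow> 0)))"

section \<open>Self-joinings\<close>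

definition self_joining :: "'a measure \<Rightarrow> ('a \<Rightarrow> 'a) \<Rightarrow> ('a \<times> 'a) measure \<Rightarrow> bool" where
  "self_joining M T \<nu> \<longleftrightarrow> sets \<nu> = sets (M \<Otimes>\<^sub>M M) \<and>
     distr \<nu> \<nu> (map_prod T T) = \<nu> \<and>
     (\<forall>A\<in>sets M. emeasure \<nu> (A \<times> space M) = emeasure M A \<and>
                 emeasure \<nu> (space M \<times> A) = emeasure M A)"

definition ergodic_self_joining :: "'a measure \<Rightarrow> ('a \<Rightarrow> 'a) \<Rightarrow> ('a \<times> 'a) measure \<Rightarrow> bool" where
  "ergodic_self_joining M T \<nu> \<longleftrightarrow> self_joining M T \<nu> \<and>
     \<not> (\<exists>\<nu>\<^sub>1 \<nu>\<^sub>2 (a::real). self_joining M T \<nu>\<^sub>1 \<and> self_joining M T \<nu>\<^sub>2 \<and> \<nu>\<^sub>1 \<noteq> \<nu>\<^sub>2 \<and>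
          0 < a \<and> a < 1 \<and>
          (\<forall>C\<in>sets (M \<Otimes>\<^sub>M M).
             emeasure \<nu> C = ennreal a * emeasure \<nu>\<^sub>1 C + ennreal (1 - a) * emeasure \<nu>\<^sub>2 C))"

definition off_diagonal :: "'a measure \<Rightarrow> ('a \<Rightarrow> 'a) \<Rightarrow> int \<Rightarrow> ('a \<times> 'a) measure" where
  "off_diagonal M T k = distr M (M \<Otimes>\<^sub>M M) (\<lambda>x. (x, int_iterate M T k x))"

definition minimal_self_joinings :: "'a measure \<Rightarrow> ('a \<Rightarrow> 'a) \<Rightarrow> bool" where
  "minimal_self_joinings M T \<longleftrightarrow>
    (\<forall>\<nu>. ergodic_self_joining M T \<nu> \<longrightarrow> (\<exists>k. \<nu> = off_diagonal M T k))"

section \<open>Off-diagonal measures on rectangles\<close>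

lemma funpow_preserving:
  assumes "f \<in> measurable M M" "distr M M f = M" "bij_betw f (space M) (space M)"
  shows "f ^^ n \<in> measurable M M \<and> distr M M (f ^^ n) = M \<and> bij_betw (f ^^ n) (space M) (space M)"
proof (induction n)
  case 0
  show ?case by (simp add: distr_id2 id_def bij_betw_def)
next
  case (Suc n)
  have "distr M M (f \<circ> (f ^^ n)) = distr (distr M M (f ^^ n)) M f"
    using Suc assms(1) by (subst distr_distr) auto
  moreover have "f \<circ> (f ^^ n) \<in> measurable M M"
    using Suc assms(1) by (auto intro: measurable_comp)
  moreover have "bij_betw (f \<circ> (f ^^ n)) (space M) (space M)"
    using Suc assms(3) by (auto intro: bij_betw_trans)
  moreover have "f ^^ Suc n = f \<circ> (f ^^ n)"
    by simp
  ultimately show ?case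
    using Suc assms(2) by metis
qed

lemma int_iterate_automorphism:
  assumes "automorphism M T"
  shows "int_iterate M T k \<in> measurable M M" "distr M M (int_iterate M T k) = M"
    "bij_betw (int_iterate M T k) (space M) (space M)"
proof -
  let ?S = "inv_into (space M) T"
  have T: "bij_betw T (space M) (space M)" "T \<in> measurable M M" "?S \<in> measurable M M"
    "distr M M T = M"
    using assms by (auto simp: automorphism_def)
  have "distr M M ?S = distr (distr M M T) M ?S"
    using T by simp
  also have "\<dots> = distr M M (?S \<circ> T)"
    using T by (intro distr_distr) auto
  also have "\<dots> = distr M M (\<lambda>x. x)"
    using T by (intro distr_cong) (auto simp: bij_betw_def)
  finally have "distr M M ?S = M"
    by (simp add: distr_id2)
  then have "?S ^^ n \<in> measurable M M \<and> distr M M (?S ^^ n) = M \<and>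
      bij_betw (?S ^^ n) (space M) (space M)" for n
    using T(3) bij_betw_inv_into[OF T(1)] by (intro funpow_preserving)
  moreover have "T ^^ n \<in> measurable M M \<and> distr M M (T ^^ n) = M \<and>
      bij_betw (T ^^ n) (space M) (space M)" for n
    using T(2,4,1) by (rule funpow_preserving)
  ultimately show "int_iterate M T k \<in> measurable M M" "distr M M (int_iterate M T k) = M"
    "bij_betw (int_iterate M T k) (space M) (space M)"
    by (simp_all add: int_iterate_def)
qed

lemma int_iterate_image_sets:
  assumes "automorphism M T" "A \<in> sets M"
  shows "int_iterate M T k ` A \<in> sets M"
proof -
  let ?S = "inv_into (space M) T"
  have T: "bij_betw T (space M) (space M)" "T \<in> measurable M M" "?S \<in> measurable M M"
    using assms by (auto simp: automorphism_def)
  have im: "T ` C \<in> sets M" "?S ` C \<in> sets M" if "C \<in> sets M" for C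
  proof -
    have C: "C \<subseteq> space M"
      using that by (rule sets.sets_into_space)
    have "T ` C = ?S -` C \<inter> space M"
    proof (intro set_eqI iffI)
      fix y assume "y \<in> T ` C"
      then show "y \<in> ?S -` C \<inter> space M"
        using C bij_betw_inv_into_left[OF T(1)] measurable_space[OF T(2)] by fastforce
    next
      fix y assume "y \<in> ?S -` C \<inter> space M"
      then show "y \<in> T ` C"
        using bij_betw_inv_into_right[OF T(1), of y] by (intro image_eqI[of _ _ "?S y"]) auto
    qed
    then show "T ` C \<in> sets M"
      using measurable_sets[OF T(3) that] by simp
    have "?S ` C = T -` C \<inter> space M"
    proof (intro set_eqI iffI)
      fix y assume "y \<in> ?S ` C"
      then show "y \<in> T -` C \<inter> space M"
        using C bij_betw_inv_into_right[OF T(1)] measurable_space[OF T(3)] by fastforce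
    next
      fix y assume "y \<in> T -` C \<inter> space M"
      then show "y \<in> ?S ` C"
        using bij_betw_inv_into_left[OF T(1), of y] by (intro image_eqI[of _ _ "T y"]) auto
    qed
    then show "?S ` C \<in> sets M"
      using measurable_sets[OF T(2) that] by simp
  qed
  have "(T ^^ n) ` A \<in> sets M \<and> (?S ^^ n) ` A \<in> sets M" for n
  proof (induction n)
    case 0
    then show ?case using assms(2) by simp
  next
    case (Suc n)
    have "(f ^^ Suc n) ` A = f ` (f ^^ n) ` A" for f :: "'a \<Rightarrow> 'a"
      by (simp add: image_comp)
    then show ?case using Suc im by metis
  qed
  then show ?thesis
    by (simp add: int_iterate_def)
qed

lemma emeasure_off_diagonal:
  assumes "automorphism M T" "A \<in> sets M" "B \<in> sets M"
  shows "emeasure (off_diagonal M T k) (A \<times> B) = emeasure M (int_iterate M T k ` A \<inter> B)"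
proof -
  let ?F = "int_iterate M T k"
  note F = int_iterate_automorphism[OF assms(1), of k]
  have A: "?F ` A \<in> sets M"
    using assms(1,2) by (rule int_iterate_image_sets)
  have sub: "A \<subseteq> space M"
    using sets.sets_into_space[OF assms(2)] .
  have "emeasure (off_diagonal M T k) (A \<times> B)
      = emeasure M ((\<lambda>x. (x, ?F x)) -` (A \<times> B) \<inter> space M)"
    unfolding off_diagonal_def using F assms(2,3) by (intro emeasure_distr) auto
  also have "(\<lambda>x. (x, ?F x)) -` (A \<times> B) \<inter> space M = ?F -` (?F ` A \<inter> B) \<inter> space M"
    using F(3) sub by (auto simp: bij_betw_def inj_on_def)
  also have "emeasure M \<dots> = emeasure (distr M M ?F) (?F ` A \<inter> B)"
    using F(1) A assms(3) by (intro emeasure_distr[symmetric]) auto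
  finally show ?thesis
    using F(2) by simp
qed

end

theory Submission
  imports Defs "HOL-Complex_Analysis.Great_Picard"
begin

text \<open>
  The idea is to compute a self-joining \<open>\<nu>\<close> on rectangles from the towers that witness rank one,
  and to read off that \<open>\<nu>\<close> is a countable convex combination of the off-diagonal measures.

  Fix a tower with base \<open>E\<close> and levels \<open>T^i E\<close>, \<open>0 \<le> i \<le> H\<close>. By invariance,
  \<open>\<nu>(T^i E \<times> T^l E)\<close> depends on \<open>k = l - i\<close> only; call it \<open>d_k \<mu>(E)\<close>. Since the levels
  are disjoint and \<open>\<nu>\<close> has marginals \<open>\<mu>\<close>, the weights satisfy \<open>\<Sum> d_k \<le> 2\<close>, however high the
  tower is. If \<open>A\<close> and \<open>B\<close> are unions of levels with index sets \<open>I\<close> and \<open>J\<close>, then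
  \<open>\<nu>(A \<times> B) = \<Sum> d_k w_k\<close>, where \<open>w_k = \<mu>(E) card {i \<in> I. i + k \<in> J}\<close> falls short of
  \<open>\<mu>(T^k A \<inter> B)\<close> only because of those levels of \<open>A\<close> that \<open>T^k\<close> carries out of the tower
  (lemmas \<open>joining_levels\<close>, \<open>overlap_ge\<close>, \<open>overlap_le\<close>).

  Mixing is used twice. First, the levels that escape are negligible (\<open>top_levels_le\<close>): if a
  level \<open>L\<close> near the top lies in \<open>A\<close>, a bounded power of \<open>T\<close> moves it to \<open>T^(H+1) E\<close>, which
  is disjoint from all levels except the base and yet is nearly covered by the tower, because it
  lies in a fixed image of \<open>A\<close>. Hence \<open>T^(H+1) E\<close> nearly equals \<open>E\<close>, so \<open>T^(H+1) L\<close> nearly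
  equals \<open>L\<close>, and \<open>\<mu>(E)\<close> is at most about \<open>\<mu>(T^(H+1) A \<inter> A)\<close>, which tends to 0 because the
  infinite measure forces the heights to grow. Second, \<open>\<mu>(T^k A \<inter> B)\<close> vanishes as \<open>k\<close> goes to
  infinity, so along a subsequence on which every \<open>d_k\<close> converges no mass is lost in the sum
  (\<open>weighted_sum_limit\<close>). This gives numbers \<open>c_k \<ge> 0\<close> with
  \<open>\<nu>(A \<times> B) = \<Sum> c_k \<mu>(T^k A \<inter> B)\<close> for all \<open>A\<close> and \<open>B\<close> of finite measure (\<open>joining_has_sum\<close>).

  Consequently \<open>\<nu> = \<Sum> c_k \<Delta>^k\<close> with \<open>\<Sum> c_k = 1\<close> (\<open>joining_eq_mixture\<close>). If \<open>\<nu>\<close> is extremal and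
  \<open>c_k > 0\<close>, then splitting off the \<open>k\<close>-th term cannot give a nontrivial decomposition, and
  \<open>\<nu> = \<Delta>^k\<close> follows.
\<close>

section \<open>Sums and measures\<close>

text \<open>
  A dominated convergence principle in which the weights \<open>d j k\<close> converge only pointwise in \<open>k\<close>, so
  that total mass up to \<open>C\<close> may escape to infinity. Nothing is lost in the sum, because far out the
  terms \<open>w j k\<close> are uniformly small: \<open>m\<close> vanishes at infinity.
\<close>

lemma weighted_sum_limit:
  fixes d w :: "nat \<Rightarrow> 'k \<Rightarrow> real" and c m :: "'k \<Rightarrow> real"
  assumes K: "\<And>j. finite (K j)" and d_nonneg: "\<And>j k. 0 \<le> d j k"
    and d_outside: "\<And>j k. k \<notin> K j \<Longrightarrow> d j k = 0"
    and d_sum: "\<And>j. (\<Sum>k\<in>K j. d j k) \<le> C"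
    and d_lim: "\<And>k. (\<lambda>j. d j k) \<longlonglongrightarrow> c k"
    and w_nonneg: "\<And>j k. 0 \<le> w j k" and w_le: "\<And>j k. w j k \<le> m k + \<delta> j"
    and \<delta>: "\<delta> \<longlonglongrightarrow> 0"
    and w_lim: "\<And>k. (\<lambda>j. w j k) \<longlonglongrightarrow> m k"
    and m_vanish: "\<And>\<epsilon>. 0 < \<epsilon> \<Longrightarrow> finite {k. \<epsilon> < m k}"
    and s: "(\<lambda>j. \<Sum>k\<in>K j. d j k * w j k) \<longlonglongrightarrow> s"
  shows "((\<lambda>k. c k * m k) has_sum s) UNIV"
  unfolding has_sum_def
proof (rule tendstoI)
  fix e :: real assume e: "0 < e"
  have "0 \<le> (\<Sum>k\<in>K 0. d 0 k)" by (intro sum_nonneg d_nonneg)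
  then have C: "0 \<le> C" using d_sum[of 0] by linarith
  define \<epsilon> where "\<epsilon> = e / (C + 1)"
  have \<epsilon>: "0 < \<epsilon>" "C * \<epsilon> < e"
    using C e by (auto simp: \<epsilon>_def field_simps)
  \<comment> \<open>Outside \<open>Y\<close> every \<open>m k\<close> is at most \<open>\<epsilon>\<close>, so that part of the \<open>j\<close>-th sum is at most about \<open>C * \<epsilon>\<close>.\<close>
  have "dist (\<Sum>k\<in>Y. c k * m k) s < e" if Y: "finite Y" "{k. \<epsilon> < m k} \<subseteq> Y" for Y
  proof -
    have split: "(\<Sum>k\<in>K j. d j k * w j k) - (\<Sum>k\<in>Y. d j k * w j k) = (\<Sum>k\<in>K j - Y. d j k * w j k)" for j
    proof -
      have "(\<Sum>k\<in>Y. d j k * w j k) = (\<Sum>k\<in>K j \<inter> Y. d j k * w j k)"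
        using Y d_outside by (intro sum.mono_neutral_right) auto
      then show ?thesis
        using sum.Int_Diff[OF K, of "\<lambda>k. d j k * w j k" j Y] by simp
    qed
    have lower: "0 \<le> (\<Sum>k\<in>K j - Y. d j k * w j k)" for j
      by (intro sum_nonneg mult_nonneg_nonneg d_nonneg w_nonneg)
    have upper: "(\<Sum>k\<in>K j - Y. d j k * w j k) \<le> C * (\<epsilon> + \<bar>\<delta> j\<bar>)" for j
    proof -
      have "(\<Sum>k\<in>K j - Y. d j k * w j k) \<le> (\<Sum>k\<in>K j - Y. d j k * (\<epsilon> + \<bar>\<delta> j\<bar>))"
      proof (intro sum_mono mult_left_mono d_nonneg)
        fix k assume "k \<in> K j - Y"
        then have "m k \<le> \<epsilon>" using Y by force
        then show "w j k \<le> \<epsilon> + \<bar>\<delta> j\<bar>" using w_le[of j k] by linarith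
      qed
      also have "\<dots> = (\<Sum>k\<in>K j - Y. d j k) * (\<epsilon> + \<bar>\<delta> j\<bar>)"
        by (simp add: sum_distrib_right)
      also have "\<dots> \<le> C * (\<epsilon> + \<bar>\<delta> j\<bar>)"
      proof (intro mult_right_mono)
        have "(\<Sum>k\<in>K j - Y. d j k) \<le> (\<Sum>k\<in>K j. d j k)"
          using K d_nonneg by (intro sum_mono2) auto
        then show "(\<Sum>k\<in>K j - Y. d j k) \<le> C" using d_sum[of j] by linarith
      qed (use \<epsilon> in auto)
      finally show ?thesis .
    qed
    have "(\<lambda>j. (\<Sum>k\<in>K j. d j k * w j k) - (\<Sum>k\<in>Y. d j k * w j k)) \<longlonglongrightarrow> s - (\<Sum>k\<in>Y. c k * m k)"
      by (intro tendsto_intros s d_lim w_lim)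
    then have lim: "(\<lambda>j. \<Sum>k\<in>K j - Y. d j k * w j k) \<longlonglongrightarrow> s - (\<Sum>k\<in>Y. c k * m k)"
      unfolding split .
    have "0 \<le> s - (\<Sum>k\<in>Y. c k * m k)"
      using lim lower by (intro LIMSEQ_le_const) auto
    moreover have "(\<lambda>j. C * (\<epsilon> + \<bar>\<delta> j\<bar>)) \<longlonglongrightarrow> C * (\<epsilon> + \<bar>0\<bar>)"
      by (intro tendsto_intros \<delta>)
    then have "s - (\<Sum>k\<in>Y. c k * m k) \<le> C * (\<epsilon> + \<bar>0\<bar>)"
      using upper by (intro LIMSEQ_le[OF lim]) auto
    ultimately show ?thesis using \<epsilon> by (simp add: dist_real_def)
  qed
  then show "\<forall>\<^sub>F Y in finite_subsets_at_top UNIV. dist (\<Sum>k\<in>Y. c k * m k) s < e"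
    unfolding eventually_finite_subsets_at_top using m_vanish[OF \<epsilon>(1)] by auto
qed

lemma nn_integral_has_sum:
  fixes f :: "'k \<Rightarrow> real"
  assumes "(f has_sum s) UNIV" "\<And>k. 0 \<le> f k"
  shows "(\<integral>\<^sup>+k. ennreal (f k) \<partial>count_space UNIV) = ennreal s"
proof -
  have "f summable_on UNIV" and s: "infsum f UNIV = s"
    using assms(1) by (simp_all add: has_sum_iff)
  then have "Infinite_Set_Sum.abs_summable_on f UNIV"
    unfolding abs_summable_equivalent[symmetric] by (simp add: assms(2))
  then show ?thesis
    using assms(2) s by (simp add: nn_integral_conv_infsetsum infsetsum_infsum)
qed

lemma tendsto_of_two_sided_bound:
  fixes f :: "nat \<Rightarrow> real"
  assumes "\<And>j. x \<le> f j + a j + b j" "\<And>j. f j \<le> x + c j + d j"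
    and "a \<longlonglongrightarrow> 0" "b \<longlonglongrightarrow> 0" "c \<longlonglongrightarrow> 0" "d \<longlonglongrightarrow> 0"
  shows "f \<longlonglongrightarrow> x"
proof (rule tendsto_sandwich)
  show "(\<lambda>j. x - a j - b j) \<longlonglongrightarrow> x" "(\<lambda>j. x + c j + d j) \<longlonglongrightarrow> x"
    using assms(3-6) by (auto intro!: tendsto_eq_intros)
  have "x - a j - b j \<le> f j" for j using assms(1)[of j] by linarith
  then show "\<forall>\<^sub>F j in sequentially. x - a j - b j \<le> f j" by simp
  show "\<forall>\<^sub>F j in sequentially. f j \<le> x + c j + d j" using assms(2) by simp
qed

lemma tendsto_squeeze:
  fixes f g h :: "nat \<Rightarrow> real"
  assumes "\<And>j. g j \<le> f j" "\<And>j. f j \<le> h j" "g \<longlonglongrightarrow> x" "h \<longlonglongrightarrow> x"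
  shows "f \<longlonglongrightarrow> x"
  using tendsto_sandwich[of g f sequentially h x] assms by simp

lemma fmeasurable_UNION: "finite I \<Longrightarrow> (\<And>i. i \<in> I \<Longrightarrow> F i \<in> fmeasurable M) \<Longrightarrow> (\<Union>i\<in>I. F i) \<in> fmeasurable M"
  by (induction I rule: finite_induct) auto

lemma measure_disjoint_UNION:
  "finite I \<Longrightarrow> (\<And>i. i \<in> I \<Longrightarrow> F i \<in> fmeasurable M) \<Longrightarrow> disjoint_family_on F I \<Longrightarrow>
    measure M (\<Union>i\<in>I. F i) = (\<Sum>i\<in>I. measure M (F i))"
  by (intro measure_UNION') (auto simp: disjoint_family_on_def pairwise_def disjnt_def)

lemma fmeasurable_space: "A \<in> fmeasurable M \<Longrightarrow> A \<subseteq> space M"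
  by (rule sets.sets_into_space) auto

lemma disjoint_Times:
  assumes "disjoint_family_on F I" "disjoint_family_on G J"
  shows "disjoint_family_on (\<lambda>(i, j). F i \<times> G j) (I \<times> J)"
  unfolding disjoint_family_on_def
proof (intro ballI impI)
  fix p q assume "p \<in> I \<times> J" "q \<in> I \<times> J" "p \<noteq> q"
  then obtain i j i' j' where "p = (i, j)" "q = (i', j')" "i \<in> I" "i' \<in> I" "j \<in> J" "j' \<in> J"
    and "i \<noteq> i' \<or> j \<noteq> j'" by auto
  then show "(case p of (i, j) \<Rightarrow> F i \<times> G j) \<inter> (case q of (i, j) \<Rightarrow> F i \<times> G j) = {}"
    using disjoint_family_onD[OF assms(1), of i i'] disjoint_family_onD[OF assms(2), of j j']
    by (auto simp only: prod.case Times_Int_Times Times_empty)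
qed

section \<open>Mixtures of measures\<close>

definition mixture :: "'b measure \<Rightarrow> ('k \<Rightarrow> ennreal) \<Rightarrow> ('k \<Rightarrow> 'b measure) \<Rightarrow> 'b measure" where
  "mixture N c P = measure_of (space N) (sets N) (\<lambda>C. \<integral>\<^sup>+k. c k * emeasure (P k) C \<partial>count_space UNIV)"

lemma sets_mixture [simp]: "sets (mixture N c P) = sets N"
  by (simp add: mixture_def sets.sigma_sets_eq sets.space_closed)

lemma emeasure_mixture:
  assumes P: "\<And>k. sets (P k) = sets N" and C: "C \<in> sets N"
  shows "emeasure (mixture N c P) C = (\<integral>\<^sup>+k. c k * emeasure (P k) C \<partial>count_space UNIV)"
proof -
  let ?m = "\<lambda>C. \<integral>\<^sup>+k. c k * emeasure (P k) C \<partial>count_space UNIV"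
  have pos: "positive (sets N) ?m"
    by (simp add: positive_def)
  have add: "countably_additive (sets N) ?m"
  proof (rule countably_additiveI)
    fix A :: "nat \<Rightarrow> 'b set" assume A: "range A \<subseteq> sets N" "disjoint_family A"
    have "(\<Sum>i. ?m (A i)) = (\<integral>\<^sup>+k. (\<Sum>i. c k * emeasure (P k) (A i)) \<partial>count_space UNIV)"
      by (rule nn_integral_suminf[symmetric]) simp
    also have "\<dots> = ?m (\<Union>i. A i)"
      using A P by (intro nn_integral_cong) (simp add: ennreal_suminf_cmult suminf_emeasure)
    finally show "(\<Sum>i. ?m (A i)) = ?m (\<Union>i. A i)" .
  qed
  show ?thesis
    unfolding mixture_def using sets.sigma_algebra_axioms pos add C by (rule emeasure_measure_of_sigma)
qed

section \<open>Integer iterates of an automorphism\<close>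

locale measure_automorphism =
  fixes M :: "'a measure" and T :: "'a \<Rightarrow> 'a"
  assumes automorphism: "automorphism M T"
begin

abbreviation iter :: "int \<Rightarrow> 'a \<Rightarrow> 'a" where "iter \<equiv> int_iterate M T"
abbreviation shift :: "int \<Rightarrow> 'a set \<Rightarrow> 'a set" where "shift k A \<equiv> iter k ` A"

lemmas iter_measurable = int_iterate_automorphism(1)[OF automorphism]
  and iter_distr = int_iterate_automorphism(2)[OF automorphism]
  and iter_bij = int_iterate_automorphism(3)[OF automorphism]
  and shift_sets = int_iterate_image_sets[OF automorphism]

lemma iter_in_space: "x \<in> space M \<Longrightarrow> iter k x \<in> space M"
  using iter_bij[of k] by (auto simp: bij_betw_def)

lemma iter_inj: "inj_on (iter k) (space M)"
  using iter_bij[of k] by (auto simp: bij_betw_def)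

lemma T_bij: "bij_betw T (space M) (space M)"
  using automorphism by (simp add: automorphism_def)

lemma iter_0 [simp]: "iter 0 x = x"
  by (simp add: int_iterate_def)

lemma iter_1: "iter 1 = T"
  by (simp add: int_iterate_def)

lemma iter_of_nat: "iter (int n) = T ^^ n"
  by (simp add: int_iterate_def)

lemma iter_plus_1:
  assumes "x \<in> space M"
  shows "iter (k + 1) x = T (iter k x)"
proof (cases "0 \<le> k")
  case True
  then show ?thesis by (simp add: int_iterate_def nat_add_distrib)
next
  case False
  let ?S = "inv_into (space M) T"
  define n where "n = nat (- (k + 1))"
  have k: "k = - int (Suc n)" using False by (simp add: n_def)
  have "(?S ^^ n) x \<in> space M"
    using iter_in_space[OF assms, of "- int n"] by (cases "n = 0") (auto simp: int_iterate_def)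
  then have "T (iter k x) = (?S ^^ n) x"
    by (simp add: int_iterate_def k nat_add_distrib bij_betw_inv_into_right[OF T_bij])
  also have "\<dots> = iter (k + 1) x"
    by (cases n) (auto simp: int_iterate_def k nat_add_distrib)
  finally show ?thesis by simp
qed

lemma iter_add:
  assumes "x \<in> space M"
  shows "iter (k + l) x = iter k (iter l x)"
proof (induction k rule: int_induct[of _ 0])
  case base
  show ?case by simp
next
  case (step1 i)
  have "iter (i + 1 + l) x = T (iter (i + l) x)"
    using iter_plus_1[OF assms, of "i + l"] by (simp add: algebra_simps)
  then show ?case
    using step1 iter_plus_1[OF iter_in_space[OF assms]] by simp
next
  case (step2 i)
  have "T (iter (i - 1 + l) x) = T (iter (i - 1) (iter l x))"
    using iter_plus_1[OF assms, of "i - 1 + l"] iter_plus_1[OF iter_in_space[OF assms], of "i - 1" l] step2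
    by (simp add: algebra_simps)
  then show ?case
    using T_bij iter_in_space assms by (auto simp: bij_betw_def inj_on_def)
qed

lemma shift_shift: "A \<subseteq> space M \<Longrightarrow> shift k (shift l A) = shift (k + l) A"
  unfolding image_image by (intro image_cong refl) (auto simp: iter_add)

lemma shift_0 [simp]: "shift 0 A = A"
  by auto

lemma shift_Diff: "A \<subseteq> space M \<Longrightarrow> B \<subseteq> space M \<Longrightarrow> shift k (A - B) = shift k A - shift k B"
  using iter_inj by (intro inj_on_image_set_diff) auto

lemma shift_Int: "A \<subseteq> space M \<Longrightarrow> B \<subseteq> space M \<Longrightarrow> shift k (A \<inter> B) = shift k A \<inter> shift k B"
  using iter_inj by (intro inj_on_image_Int) auto

lemma emeasure_shift:
  assumes "A \<in> sets M"
  shows "emeasure M (shift k A) = emeasure M A"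
proof -
  have "iter k -` shift k A \<inter> space M = A"
    using iter_inj[of k] sets.sets_into_space[OF assms] by (auto simp: inj_on_def)
  then show ?thesis
    using emeasure_distr[OF iter_measurable shift_sets[OF assms], of k k] by (simp add: iter_distr)
qed

lemma shift_fmeasurable [intro, simp]: "A \<in> fmeasurable M \<Longrightarrow> shift k A \<in> fmeasurable M"
  using emeasure_shift[of A k] shift_sets[of A k] by (auto simp: fmeasurable_def)

lemma measure_shift: "A \<in> sets M \<Longrightarrow> measure M (shift k A) = measure M A"
  by (simp add: measure_def emeasure_shift)

lemma shift_Int_shift:
  assumes "A \<subseteq> space M" "B \<subseteq> space M"
  shows "shift k A \<inter> shift l B = shift l (shift (k - l) A \<inter> B)"
proof -
  have "shift (k - l) A \<subseteq> space M" using assms iter_in_space by auto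
  then show ?thesis using assms by (simp add: shift_Int shift_shift)
qed

end

section \<open>Self-joinings\<close>

context measure_automorphism
begin

lemma map_prod_measurable: "map_prod T T \<in> measurable (M \<Otimes>\<^sub>M M) (M \<Otimes>\<^sub>M M)"
proof -
  have [measurable]: "T \<in> measurable M M" using automorphism by (simp add: automorphism_def)
  show ?thesis unfolding map_prod_def by measurable
qed

lemma emeasure_joining_shift:
  assumes \<nu>: "self_joining M T \<nu>" and A: "A \<in> sets M" and B: "B \<in> sets M"
  shows "emeasure \<nu> (shift k A \<times> shift k B) = emeasure \<nu> (A \<times> B)"
proof -
  have sets_\<nu>: "sets \<nu> = sets (M \<Otimes>\<^sub>M M)" and inv: "distr \<nu> \<nu> (map_prod T T) = \<nu>"
    using \<nu> by (auto simp: self_joining_def)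
  have space_\<nu>: "space \<nu> = space M \<times> space M"
    using sets_eq_imp_space_eq[OF sets_\<nu>] by (simp add: space_pair_measure)
  have T_meas: "map_prod T T \<in> measurable \<nu> \<nu>"
    using map_prod_measurable by (simp add: measurable_cong_sets[OF sets_\<nu> sets_\<nu>])
  have step: "emeasure \<nu> (T ` A \<times> T ` B) = emeasure \<nu> (A \<times> B)" if "A \<in> sets M" "B \<in> sets M" for A B
  proof -
    have img: "T ` A \<in> sets M" "T ` B \<in> sets M"
      using shift_sets[of A 1] shift_sets[of B 1] that by (simp_all add: iter_1)
    have "map_prod T T -` (T ` A \<times> T ` B) \<inter> space \<nu> = A \<times> B"
    proof -
      have "inj_on T (space M)" using T_bij by (simp add: bij_betw_def)
      then have pre: "T -` (T ` C) \<inter> space M = C" if "C \<in> sets M" for C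
        using sets.sets_into_space[OF that] by (blast dest: inj_onD)
      have "map_prod T T -` (T ` A \<times> T ` B) \<inter> space \<nu>
          = (T -` (T ` A) \<inter> space M) \<times> (T -` (T ` B) \<inter> space M)"
        by (auto simp: space_\<nu>)
      then show ?thesis by (simp only: pre that)
    qed
    moreover have "emeasure (distr \<nu> \<nu> (map_prod T T)) (T ` A \<times> T ` B)
        = emeasure \<nu> (map_prod T T -` (T ` A \<times> T ` B) \<inter> space \<nu>)"
      using T_meas img by (intro emeasure_distr) (auto simp: sets_\<nu>)
    ultimately show ?thesis using inv by simp
  qed
  have AB: "A \<subseteq> space M" "B \<subseteq> space M"
    using A B sets.sets_into_space by auto
  have T_shift: "T ` shift i A = shift (i + 1) A" "T ` shift i B = shift (i + 1) B" for i
    unfolding image_image using AB by (auto intro!: image_cong simp: iter_plus_1)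
  show ?thesis
  proof (induction k rule: int_induct[of _ 0])
    case (step1 i)
    show ?case
      using step[of "shift i A" "shift i B"] A B step1 shift_sets by (simp add: T_shift)
  next
    case (step2 i)
    show ?case
      using step[of "shift (i - 1) A" "shift (i - 1) B"] A B step2 shift_sets by (simp add: T_shift)
  qed simp
qed

lemma joining_sets: "self_joining M T \<nu> \<Longrightarrow> sets \<nu> = sets (M \<Otimes>\<^sub>M M)"
  by (simp add: self_joining_def)

lemma joining_fmeasurable:
  assumes \<nu>: "self_joining M T \<nu>" and "A \<in> sets M" "B \<in> sets M"
    and fin: "A \<in> fmeasurable M \<or> B \<in> fmeasurable M"
  shows "A \<times> B \<in> fmeasurable \<nu>"
proof -
  have sub: "A \<times> B \<subseteq> A \<times> space M" "A \<times> B \<subseteq> space M \<times> B"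
    using assms sets.sets_into_space by auto
  have "A \<times> B \<in> sets \<nu>" using assms by (auto simp: joining_sets)
  moreover have "A \<times> space M \<in> fmeasurable \<nu> \<or> space M \<times> B \<in> fmeasurable \<nu>"
    using assms by (auto simp: fmeasurable_def self_joining_def)
  ultimately show ?thesis using sub fmeasurableI2 by metis
qed

lemma measure_joining_le:
  assumes \<nu>: "self_joining M T \<nu>"
    and "A \<in> fmeasurable M" "A' \<in> fmeasurable M" "B \<in> fmeasurable M" "B' \<in> fmeasurable M"
  shows "measure \<nu> (A \<times> B) \<le> measure \<nu> (A' \<times> B') + measure M (A - A') + measure M (B - B')"
proof -
  have fm: "A' \<times> B' \<in> fmeasurable \<nu>" "(A - A') \<times> space M \<in> fmeasurable \<nu>" "space M \<times> (B - B') \<in> fmeasurable \<nu>"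
    "A \<times> B \<in> fmeasurable \<nu>"
    using assms by (auto intro!: joining_fmeasurable[OF \<nu>])
  have "A \<times> B \<subseteq> (A' \<times> B' \<union> (A - A') \<times> space M) \<union> space M \<times> (B - B')"
    using assms(2,4)[THEN fmeasurable_space] by auto
  then have "measure \<nu> (A \<times> B) \<le> measure \<nu> ((A' \<times> B' \<union> (A - A') \<times> space M) \<union> space M \<times> (B - B'))"
    using fm by (intro measure_mono_fmeasurable fmeasurable.Un) auto
  also have "\<dots> \<le> measure \<nu> (A' \<times> B' \<union> (A - A') \<times> space M) + measure \<nu> (space M \<times> (B - B'))"
    using fm by (intro measure_Un_le) auto
  also have "\<dots> \<le> measure \<nu> (A' \<times> B') + measure \<nu> ((A - A') \<times> space M) + measure \<nu> (space M \<times> (B - B'))"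
    using fm by (intro add_right_mono measure_Un_le) auto
  also have "measure \<nu> ((A - A') \<times> space M) = measure M (A - A')"
    using assms by (auto simp: self_joining_def measure_def)
  also have "measure \<nu> (space M \<times> (B - B')) = measure M (B - B')"
    using assms by (auto simp: self_joining_def measure_def)
  finally show ?thesis .
qed

lemma measure_shift_Int_le:
  assumes "A \<in> fmeasurable M" "A' \<in> fmeasurable M" "B \<in> fmeasurable M" "B' \<in> fmeasurable M"
  shows "measure M (shift k A \<inter> B) \<le> measure M (shift k A' \<inter> B') + measure M (A - A') + measure M (B - B')"
proof -
  have "measure M (shift k A \<inter> B) \<le> measure M ((shift k A' \<inter> B') \<union> (shift k (A - A') \<union> (B - B')))"
    using assms by (intro measure_mono_fmeasurable fmeasurable.Un fmeasurable.Int fmeasurable.Diff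
        shift_fmeasurable fmeasurableD) auto
  also have "\<dots> \<le> measure M (shift k A' \<inter> B') + measure M (shift k (A - A') \<union> (B - B'))"
    using assms by (intro measure_Un_le fmeasurableD fmeasurable.Un fmeasurable.Int fmeasurable.Diff
        shift_fmeasurable)
  also have "measure M (shift k (A - A') \<union> (B - B')) \<le> measure M (shift k (A - A')) + measure M (B - B')"
    using assms by (intro measure_Un_le fmeasurableD fmeasurable.Diff shift_fmeasurable)
  also have "measure M (shift k (A - A')) = measure M (A - A')"
    using assms by (intro measure_shift) auto
  finally show ?thesis by simp
qed

lemma self_joining_iff_emeasure:
  "self_joining M T \<nu> \<longleftrightarrow> sets \<nu> = sets (M \<Otimes>\<^sub>M M) \<and>
     (\<forall>C\<in>sets (M \<Otimes>\<^sub>M M). emeasure \<nu> (map_prod T T -` C \<inter> space (M \<Otimes>\<^sub>M M)) = emeasure \<nu> C) \<and>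
     (\<forall>A\<in>sets M. emeasure \<nu> (A \<times> space M) = emeasure M A \<and> emeasure \<nu> (space M \<times> A) = emeasure M A)"
proof (cases "sets \<nu> = sets (M \<Otimes>\<^sub>M M)")
  case True
  note sp = sets_eq_imp_space_eq[OF True]
  have T: "map_prod T T \<in> measurable \<nu> \<nu>"
    using map_prod_measurable by (simp add: measurable_cong_sets[OF True True])
  have "distr \<nu> \<nu> (map_prod T T) = \<nu> \<longleftrightarrow>
      (\<forall>C\<in>sets \<nu>. emeasure (distr \<nu> \<nu> (map_prod T T)) C = emeasure \<nu> C)"
    by (metis measure_eqI sets_distr)
  also have "\<dots> \<longleftrightarrow> (\<forall>C\<in>sets \<nu>. emeasure \<nu> (map_prod T T -` C \<inter> space \<nu>) = emeasure \<nu> C)"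
    by (simp add: emeasure_distr[OF T])
  finally show ?thesis
    by (simp add: self_joining_def True sp)
qed (simp add: self_joining_def)

lemma self_joining_mixture:
  assumes P: "\<And>k. self_joining M T (P k)" and c: "(\<integral>\<^sup>+k. c k \<partial>count_space UNIV) = 1"
  shows "self_joining M T (mixture (M \<Otimes>\<^sub>M M) c P)"
proof -
  have sets_P: "sets (P k) = sets (M \<Otimes>\<^sub>M M)" for k
    using P by (simp add: self_joining_def)
  have pre: "map_prod T T -` C \<inter> space (M \<Otimes>\<^sub>M M) \<in> sets (M \<Otimes>\<^sub>M M)" if "C \<in> sets (M \<Otimes>\<^sub>M M)" for C
    using map_prod_measurable that by (rule measurable_sets)
  have marginal: "(\<integral>\<^sup>+k. c k * emeasure M A \<partial>count_space UNIV) = emeasure M A" for A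
    by (simp add: nn_integral_multc c)
  have inv: "emeasure (P k) (map_prod T T -` C \<inter> space (M \<Otimes>\<^sub>M M)) = emeasure (P k) C"
    if "C \<in> sets (M \<Otimes>\<^sub>M M)" for k C
    using P[of k] that unfolding self_joining_iff_emeasure by blast
  have marg: "emeasure (P k) (A \<times> space M) = emeasure M A" "emeasure (P k) (space M \<times> A) = emeasure M A"
    if "A \<in> sets M" for k A
    using P[of k] that unfolding self_joining_iff_emeasure by blast+
  have mix: "emeasure (mixture (M \<Otimes>\<^sub>M M) c P) C = (\<integral>\<^sup>+k. c k * emeasure (P k) C \<partial>count_space UNIV)"
    if "C \<in> sets (M \<Otimes>\<^sub>M M)" for C
    by (rule emeasure_mixture[OF sets_P that])
  show ?thesis
    unfolding self_joining_iff_emeasure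
    by (intro conjI ballI) (simp_all add: mix pre inv marg marginal)
qed

lemma T_iter_commute: "x \<in> space M \<Longrightarrow> T (iter k x) = iter k (T x)"
  using iter_plus_1[of x k] iter_add[of x k 1] by (simp add: iter_1)

lemma self_joining_off_diagonal: "self_joining M T (off_diagonal M T k)"
proof -
  have T: "T \<in> measurable M M" "distr M M T = M"
    using automorphism by (auto simp: automorphism_def)
  have g: "(\<lambda>x. (x, iter k x)) \<in> measurable M (M \<Otimes>\<^sub>M M)"
    using iter_measurable[of k] by measurable
  have "distr (off_diagonal M T k) (M \<Otimes>\<^sub>M M) (map_prod T T)
      = distr M (M \<Otimes>\<^sub>M M) (map_prod T T \<circ> (\<lambda>x. (x, iter k x)))"
    unfolding off_diagonal_def by (rule distr_distr[OF map_prod_measurable g])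
  also have "\<dots> = distr M (M \<Otimes>\<^sub>M M) ((\<lambda>x. (x, iter k x)) \<circ> T)"
    by (rule distr_cong) (simp_all add: T_iter_commute)
  also have "\<dots> = distr (distr M M T) (M \<Otimes>\<^sub>M M) (\<lambda>x. (x, iter k x))"
    by (rule distr_distr[OF g T(1), symmetric])
  finally have inv: "distr (off_diagonal M T k) (M \<Otimes>\<^sub>M M) (map_prod T T) = off_diagonal M T k"
    by (simp add: T(2) off_diagonal_def)
  have sets: "sets (off_diagonal M T k) = sets (M \<Otimes>\<^sub>M M)"
    by (simp add: off_diagonal_def)
  have "distr (off_diagonal M T k) (off_diagonal M T k) (map_prod T T)
      = distr (off_diagonal M T k) (M \<Otimes>\<^sub>M M) (map_prod T T)"
    by (rule distr_cong) (simp_all add: sets)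
  moreover have "emeasure (off_diagonal M T k) (A \<times> space M) = emeasure M A"
    "emeasure (off_diagonal M T k) (space M \<times> A) = emeasure M A" if A: "A \<in> sets M" for A
  proof -
    have "shift k A \<inter> space M = shift k A" "shift k (space M) \<inter> A = A"
      using sets.sets_into_space[OF A] iter_bij[of k] by (auto simp: bij_betw_def)
    then show "emeasure (off_diagonal M T k) (A \<times> space M) = emeasure M A"
      "emeasure (off_diagonal M T k) (space M \<times> A) = emeasure M A"
      using A by (simp_all add: emeasure_off_diagonal[OF automorphism] emeasure_shift)
  qed
  ultimately show ?thesis
    using inv sets by (simp add: self_joining_def)
qed

text \<open>
  By sigma-finiteness every rectangle is an increasing union of rectangles with sides of finite
  measure, and the rectangles form a generator stable under intersection.
\<close>

lemma self_joining_eqI: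
  fixes \<nu> \<nu>' :: "('a \<times> 'a) measure"
  assumes "sigma_finite_measure M" and \<nu>: "self_joining M T \<nu>" and \<nu>': "sets \<nu>' = sets (M \<Otimes>\<^sub>M M)"
    and eq: "\<And>A B. A \<in> fmeasurable M \<Longrightarrow> B \<in> fmeasurable M \<Longrightarrow> emeasure \<nu> (A \<times> B) = emeasure \<nu>' (A \<times> B)"
  shows "\<nu> = \<nu>'"
proof -
  interpret sigma_finite_measure M by fact
  obtain S :: "nat \<Rightarrow> 'a set" where S: "range S \<subseteq> sets M" "(\<Union>i. S i) = space M" "\<And>i. emeasure M (S i) \<noteq> \<infinity>" "incseq S"
    using sigma_finite_incseq by blast
  have S_sets: "S i \<in> sets M" for i using S(1) by auto
  have S_fm: "S i \<in> fmeasurable M" for i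
    using S(3)[of i] S_sets by (intro fmeasurableI) (auto simp: less_top)
  have exhaust: "(SUP n. emeasure \<rho> ((A \<inter> S n) \<times> (B \<inter> S n))) = emeasure \<rho> (A \<times> B)"
    if \<rho>: "sets \<rho> = sets (M \<Otimes>\<^sub>M M)" and A: "A \<in> sets M" and B: "B \<in> sets M"
    for \<rho> :: "('a \<times> 'a) measure" and A B
  proof -
    have "(\<Union>n. (A \<inter> S n) \<times> (B \<inter> S n)) = A \<times> B"
    proof (intro equalityI subsetI)
      fix p assume "p \<in> A \<times> B"
      then obtain x y where p: "p = (x, y)" "x \<in> A" "y \<in> B" by auto
      then have "x \<in> space M" "y \<in> space M" using A B sets.sets_into_space by auto
      then obtain i j where "x \<in> S i" "y \<in> S j" using S(2) by blast
      then have "x \<in> S (max i j)" "y \<in> S (max i j)"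
        using incseqD[OF S(4), of i "max i j"] incseqD[OF S(4), of j "max i j"] by auto
      then show "p \<in> (\<Union>n. (A \<inter> S n) \<times> (B \<inter> S n))" using p by auto
    qed auto
    moreover have "incseq (\<lambda>n. (A \<inter> S n) \<times> (B \<inter> S n))"
      using S(4) unfolding incseq_def by blast
    moreover have "range (\<lambda>n. (A \<inter> S n) \<times> (B \<inter> S n)) \<subseteq> sets \<rho>"
      using A B S_sets by (auto simp: \<rho>)
    ultimately show ?thesis using SUP_emeasure_incseq[of "\<lambda>n. (A \<inter> S n) \<times> (B \<inter> S n)" \<rho>] by simp
  qed
  have rect: "emeasure \<nu> (A \<times> B) = emeasure \<nu>' (A \<times> B)" if "A \<in> sets M" "B \<in> sets M" for A B
  proof -
    have "emeasure \<nu> ((A \<inter> S n) \<times> (B \<inter> S n)) = emeasure \<nu>' ((A \<inter> S n) \<times> (B \<inter> S n))" for n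
      using fmeasurable_Int_fmeasurable[OF S_fm that(1), of n] fmeasurable_Int_fmeasurable[OF S_fm that(2), of n]
      by (intro eq) (simp_all add: Int_commute)
    then show ?thesis
      using exhaust[OF joining_sets[OF \<nu>] that] exhaust[OF \<nu>' that] by simp
  qed
  show ?thesis
  proof (rule measure_eqI_generator_eq)
    show "Int_stable {A \<times> B | A B. A \<in> sets M \<and> B \<in> sets M}"
      by (rule Int_stable_pair_measure_generator)
    show "{A \<times> B | A B. A \<in> sets M \<and> B \<in> sets M} \<subseteq> Pow (space M \<times> space M)"
      by (rule pair_measure_closed)
    show "emeasure \<nu> X = emeasure \<nu>' X" if "X \<in> {A \<times> B | A B. A \<in> sets M \<and> B \<in> sets M}" for X
      using that rect by auto
    show "sets \<nu> = sigma_sets (space M \<times> space M) {A \<times> B | A B. A \<in> sets M \<and> B \<in> sets M}"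
      "sets \<nu>' = sigma_sets (space M \<times> space M) {A \<times> B | A B. A \<in> sets M \<and> B \<in> sets M}"
      using joining_sets[OF \<nu>] \<nu>' by (simp_all add: sets_pair_measure)
    show "range (\<lambda>n. S n \<times> space M) \<subseteq> {A \<times> B | A B. A \<in> sets M \<and> B \<in> sets M}"
      using S_sets by auto
    show "(\<Union>n. S n \<times> space M) = space M \<times> space M" using S(2) by blast
    show "emeasure \<nu> (S n \<times> space M) \<noteq> \<infinity>" for n
      using \<nu> S(3) S_sets by (simp add: self_joining_def)
  qed
qed

text \<open>
  If \<open>0 < c k < 1\<close>, then \<open>\<nu>\<close> is a proper convex combination of \<open>\<Delta>^k\<close> and the normalised
  mixture \<open>\<nu>\<^sub>2\<close> of the other terms. Extremality forces \<open>\<nu>\<^sub>2 = \<Delta>^k\<close>, and therefore \<open>\<nu> = \<Delta>^k\<close>.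
\<close>

lemma extremal_mixture_eq_off_diagonal:
  assumes erg: "ergodic_self_joining M T \<nu>" and c: "(\<integral>\<^sup>+k. c k \<partial>count_space UNIV) = 1"
    and \<nu>: "\<nu> = mixture (M \<Otimes>\<^sub>M M) c (off_diagonal M T)"
  shows "\<exists>k. \<nu> = off_diagonal M T k"
proof -
  let ?D = "off_diagonal M T" and ?N = "count_space (UNIV :: int set)"
  have sets_D: "sets (?D k) = sets (M \<Otimes>\<^sub>M M)" for k by (simp add: off_diagonal_def)
  have sets_\<nu>: "sets \<nu> = sets (M \<Otimes>\<^sub>M M)" by (simp add: \<nu>)
  have "\<exists>k. c k \<noteq> 0"
  proof (rule ccontr)
    assume "\<nexists>k. c k \<noteq> 0"
    then have "(\<integral>\<^sup>+k. c k \<partial>?N) = 0" by simp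
    then show False using c by simp
  qed
  then obtain k where k: "c k \<noteq> 0" by blast
  define b where "b l = (if l = k then 0 else c l)" for l
  have split: "(\<integral>\<^sup>+l. c l * g l \<partial>?N) = c k * g k + (\<integral>\<^sup>+l. b l * g l \<partial>?N)" for g
  proof -
    have "(\<integral>\<^sup>+l. c l * g l \<partial>?N) = (\<integral>\<^sup>+l. c k * g k * indicator {k} l + b l * g l \<partial>?N)"
      by (intro nn_integral_cong) (auto simp: b_def)
    also have "\<dots> = c k * g k + (\<integral>\<^sup>+l. b l * g l \<partial>?N)"
      by (subst nn_integral_add) (simp_all add: nn_integral_cmult)
    finally show ?thesis .
  qed
  have total: "c k + (\<integral>\<^sup>+l. b l \<partial>?N) = 1"
    using split[of "\<lambda>_. 1"] c by simp
  then have "c k \<le> 1" by (metis le_iff_add)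
  then obtain a where a: "c k = ennreal a" "0 \<le> a" "a \<le> 1"
    by (metis ennreal_cases ennreal_le_1 ennreal_one_neq_top top.extremum_uniqueI)
  have a_pos: "0 < a" using k a by (cases "a = 0") auto
  have rest: "(\<integral>\<^sup>+l. b l \<partial>?N) = ennreal (1 - a)"
  proof -
    have "ennreal a + (\<integral>\<^sup>+l. b l \<partial>?N) = ennreal a + ennreal (1 - a)"
      using total a by (simp flip: ennreal_plus)
    then show ?thesis by (simp add: ennreal_add_left_cancel)
  qed
  have "\<nu> = ?D k"
  proof (cases "a = 1")
    case True
    then have "(\<integral>\<^sup>+l. b l \<partial>?N) = 0" using rest by simp
    then have b0: "b l = 0" for l by (simp add: nn_integral_0_iff_AE AE_count_space)
    show ?thesis
    proof (rule measure_eqI)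
      fix C assume C: "C \<in> sets \<nu>"
      show "emeasure \<nu> C = emeasure (?D k) C"
        using C unfolding \<nu> by (simp add: emeasure_mixture[OF sets_D] split b0 a True)
    qed (simp add: sets_\<nu> sets_D)
  next
    case False
    then have a1: "a < 1" using a by simp
    define \<nu>\<^sub>2 where "\<nu>\<^sub>2 = mixture (M \<Otimes>\<^sub>M M) (\<lambda>l. b l / ennreal (1 - a)) ?D"
    have "(\<integral>\<^sup>+l. b l / ennreal (1 - a) \<partial>?N) = 1"
      using a1 by (simp add: nn_integral_divide rest ennreal_divide_self)
    then have J2: "self_joining M T \<nu>\<^sub>2"
      unfolding \<nu>\<^sub>2_def by (intro self_joining_mixture self_joining_off_diagonal)
    have decomposition: "emeasure \<nu> C = ennreal a * emeasure (?D k) C + ennreal (1 - a) * emeasure \<nu>\<^sub>2 C"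
      if C: "C \<in> sets (M \<Otimes>\<^sub>M M)" for C
    proof -
      have "ennreal (1 - a) * (x / ennreal (1 - a)) = x" for x
        using a1 by (simp add: ennreal_times_divide mult.commute mult_divide_eq_ennreal)
      then have "ennreal (1 - a) * emeasure \<nu>\<^sub>2 C = (\<integral>\<^sup>+l. b l * emeasure (?D l) C \<partial>?N)"
        unfolding \<nu>\<^sub>2_def emeasure_mixture[OF sets_D C]
        by (subst nn_integral_cmult[symmetric]) (simp_all flip: mult.assoc)
      then show ?thesis
        unfolding \<nu> emeasure_mixture[OF sets_D C] split a(1) by simp
    qed
    have "\<nu>\<^sub>2 = ?D k"
      using erg self_joining_off_diagonal[of k] J2 decomposition a_pos a1
      unfolding ergodic_self_joining_def by metis
    show ?thesis
    proof (rule measure_eqI)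
      fix C assume "C \<in> sets \<nu>"
      then have "emeasure \<nu> C = (ennreal a + ennreal (1 - a)) * emeasure (?D k) C"
        using decomposition[of C] by (simp add: sets_\<nu> \<open>\<nu>\<^sub>2 = ?D k\<close> distrib_right)
      then show "emeasure \<nu> C = emeasure (?D k) C"
        using a by (simp flip: ennreal_plus)
    qed (simp add: sets_\<nu> sets_D)
  qed
  then show ?thesis by blast
qed

end

section \<open>Towers\<close>


context measure_automorphism
begin
abbreviation levels :: "'a set \<Rightarrow> int set \<Rightarrow> 'a set" where
  "levels E I \<equiv> (\<Union>i\<in>I. shift i E)"
end

text \<open>
  Levels are indexed by integers, so that differences of levels and images of levels outside the
  tower need no case distinction.
\<close>

locale tower = measure_automorphism +
  fixes E :: "'a set" and H :: int
  assumes base: "E \<in> fmeasurable M" and height: "0 \<le> H"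
    and disjoint: "disjoint_family_on (\<lambda>i. shift i E) {0..H}"
begin

lemma base_sets: "E \<in> sets M" and base_space: "E \<subseteq> space M"
  using base fmeasurable_space by auto

lemma level_space: "shift i E \<subseteq> space M"
  using base_space iter_in_space by auto

lemma levels_fmeasurable: "finite I \<Longrightarrow> levels E I \<in> fmeasurable M"
  by (intro fmeasurable_UNION shift_fmeasurable base)

lemma measure_levels: "I \<subseteq> {0..H} \<Longrightarrow> measure M (levels E I) = card I * measure M E"
  using disjoint_family_on_mono[OF _ disjoint] finite_subset[of I "{0..H}"]
  by (subst measure_disjoint_UNION) (auto intro!: shift_fmeasurable base simp: measure_shift base_sets)

lemma levels_disjoint: "i \<in> {0..H} \<Longrightarrow> l \<in> {0..H} \<Longrightarrow> x \<in> shift i E \<Longrightarrow> x \<in> shift l E \<Longrightarrow> i = l"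
  using disjoint unfolding disjoint_family_on_def by (metis IntI emptyE)

lemma shift_levels: "shift k (levels E I) = levels E ((\<lambda>i. i + k) ` I)"
proof -
  have "shift k (levels E I) = (\<Union>i\<in>I. shift k (shift i E))" by (rule image_UN)
  also have "\<dots> = (\<Union>i\<in>I. shift (i + k) E)" by (simp add: shift_shift[OF base_space] add.commute)
  finally show ?thesis by simp
qed

lemma shift_disjoint:
  assumes "\<And>i. i \<in> I \<Longrightarrow> i + k \<in> {0..H}"
  shows "disjoint_family_on (\<lambda>i. shift i E) I"
  unfolding disjoint_family_on_def
proof (intro ballI impI equals0I)
  fix i l x assume il: "i \<in> I" "l \<in> I" "i \<noteq> l" and "x \<in> shift i E \<inter> shift l E"
  then have x: "x \<in> shift i E" "x \<in> shift l E" by auto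
  have "iter k x \<in> shift k (shift i E)" "iter k x \<in> shift k (shift l E)"
    using x by blast+
  then have "iter k x \<in> shift (i + k) E" "iter k x \<in> shift (l + k) E"
    by (simp_all add: shift_shift[OF base_space] add.commute)
  then show False
    using levels_disjoint[of "i + k" "l + k"] il assms by auto
qed

text \<open>
  Let \<open>A\<close> and \<open>B\<close> be the unions of the levels in \<open>I\<close> and in \<open>J\<close>. Each \<open>i \<in> I\<close> with \<open>i + k \<in> J\<close>
  contributes one whole level to \<open>T^k A \<inter> B\<close>. What is not counted in this way comes from levels of \<open>A\<close>
  that \<open>T^k\<close> moves out of the tower range, where they may overlap \<open>B\<close> arbitrarily.
\<close>

lemma overlap_ge:
  assumes "I \<subseteq> {0..H}" "J \<subseteq> {0..H}"
  shows "measure M E * card {i \<in> I. i + k \<in> J} \<le> measure M (shift k (levels E I) \<inter> levels E J)"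
proof -
  let ?G = "(\<lambda>i. i + k) ` {i \<in> I. i + k \<in> J}"
  have fin: "finite I" "finite J" using assms finite_subset by auto
  have "measure M E * card {i \<in> I. i + k \<in> J} = measure M (levels E ?G)"
    using assms by (subst measure_levels) (auto simp: card_image inj_on_def)
  also have "\<dots> \<le> measure M (shift k (levels E I) \<inter> levels E J)"
    using fin unfolding shift_levels
    by (intro measure_mono_fmeasurable fmeasurable.Int levels_fmeasurable fmeasurableD) auto
  finally show ?thesis .
qed

lemma overlap_le:
  assumes "I \<subseteq> {0..H}" "J \<subseteq> {0..H}"
  shows "measure M (shift k (levels E I) \<inter> levels E J)
    \<le> measure M E * card {i \<in> I. i + k \<in> J} + measure M E * card {i \<in> I. i + k \<notin> {0..H}}"
proof -
  let ?G = "(\<lambda>i. i + k) ` {i \<in> I. i + k \<in> J}" and ?R = "{i \<in> I. i + k \<notin> {0..H}}"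
  have fin: "finite I" "finite J" using assms finite_subset by auto
  have "shift k (levels E I) \<inter> levels E J \<subseteq> levels E ?G \<union> shift k (levels E ?R)"
    unfolding shift_levels
  proof
    fix x assume "x \<in> levels E ((\<lambda>i. i + k) ` I) \<inter> levels E J"
    then obtain i l where il: "i \<in> I" "l \<in> J" "x \<in> shift (i + k) E" "x \<in> shift l E" by auto
    show "x \<in> levels E ?G \<union> levels E ((\<lambda>i. i + k) ` ?R)"
    proof (cases "i + k \<in> {0..H}")
      case True
      then have "i + k = l" using levels_disjoint il assms by blast
      then show ?thesis using il by auto
    next
      case False
      then have "i \<in> ?R" using il by simp
      then show ?thesis using il(3) by blast
    qed
  qed
  then have "measure M (shift k (levels E I) \<inter> levels E J) \<le> measure M (levels E ?G \<union> shift k (levels E ?R))"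
    using fin unfolding shift_levels
    by (intro measure_mono_fmeasurable fmeasurable.Un levels_fmeasurable sets.Int fmeasurableD) auto
  also have "\<dots> \<le> measure M (levels E ?G) + measure M (shift k (levels E ?R))"
    using fin by (intro measure_Un_le shift_sets fmeasurableD levels_fmeasurable) auto
  also have "measure M (shift k (levels E ?R)) = measure M (levels E ?R)"
    using fin by (intro measure_shift fmeasurableD levels_fmeasurable) auto
  also have "\<dots> = measure M E * card ?R"
    using assms by (subst measure_levels) auto
  also have "measure M (levels E ?G) = measure M E * card {i \<in> I. i + k \<in> J}"
    using assms by (subst measure_levels) (auto simp: card_image inj_on_def)
  finally show ?thesis by simp
qed

text \<open>
  At most \<open>k\<close> levels are pushed over the top, so it suffices to bound \<open>\<mu>(E)\<close> when at least one
  level \<open>L\<close> of \<open>I\<close> is. Its image \<open>T^(H+1) E = T^r L\<close> meets the tower in the base only, and it nearly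
  lies in \<open>T^r A\<close>; so whatever of it is not in \<open>E\<close> is lost either from \<open>A\<close> or from the tower. Thus
  \<open>T^(H+1)\<close> nearly maps \<open>E\<close> to itself, hence also \<open>L\<close>, and \<open>\<mu>(L)\<close> is controlled by the return
  \<open>T^(H+1) A \<inter> A\<close>.
\<close>

lemma top_levels_le:
  assumes A: "A \<in> fmeasurable M" and I: "I \<subseteq> {0..H}" and k: "0 \<le> k"
  shows "measure M E * card {i \<in> I. i + k \<notin> {0..H}}
    \<le> k * (measure M (shift (H + 1) A \<inter> A) + 3 * measure M (levels E I - A)
          + (\<Sum>r\<in>{1..k}. measure M (shift r A - levels E {0..H})))"
    (is "_ \<le> of_int k * ?bound")
proof (cases "{i \<in> I. i + k \<notin> {0..H}} = {}")
  case True
  have "0 \<le> ?bound" by (intro add_nonneg_nonneg sum_nonneg) auto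
  then have "0 \<le> k * ?bound" using k by simp
  then show ?thesis unfolding True by simp
next
  case False
  then obtain i where i: "i \<in> I" "H < i + k" "0 \<le> i" "i \<le> H"
    using I k by (auto simp: subset_iff)
  define L where "L = shift i E"
  define r where "r = H + 1 - i"
  have r: "r \<in> {1..k}" using i by (auto simp: r_def)
  have fin: "finite I" using I finite_subset by auto
  have A': "A \<in> sets M" "A \<subseteq> space M" using A fmeasurable_space by auto
  have L: "L \<in> fmeasurable M" "L \<in> sets M" "L \<subseteq> space M" "measure M L = measure M E"
    using base base_sets level_space shift_sets by (auto simp: L_def measure_shift)
  have tower: "levels E {0..H} \<in> sets M" "levels E I \<in> fmeasurable M"
    using fin by (auto intro!: levels_fmeasurable fmeasurableD)
  have LI: "measure M (L - A) \<le> measure M (levels E I - A)"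
    using L A' i(1) tower by (intro measure_mono_fmeasurable fmeasurable_Diff) (auto simp: L_def)
  have top: "shift (H + 1) E = shift r L"
    by (simp add: L_def shift_shift[OF base_space] r_def)
  \<comment> \<open>Pulled back by \<open>T\<close>, a meeting with level \<open>l \<ge> 1\<close> would be one of the top level with level \<open>l - 1\<close>.\<close>
  have "shift (H + 1) E - E \<subseteq> shift r (L - A) \<union> (shift r A - levels E {0..H})"
  proof
    fix x assume x: "x \<in> shift (H + 1) E - E"
    have "x \<notin> levels E {0..H}"
    proof
      assume "x \<in> levels E {0..H}"
      then obtain l where l: "l \<in> {0..H}" "x \<in> shift l E" by auto
      moreover have "l \<noteq> 0" using l x by auto
      ultimately have "shift (H + 1) E \<inter> shift l E \<noteq> {}" "l - 1 \<in> {0..H}" "H \<noteq> l - 1" using x by auto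
      moreover have "shift (H + 1) E \<inter> shift l E = shift 1 (shift H E \<inter> shift (l - 1) E)"
        by (simp add: shift_Int level_space shift_shift[OF base_space] algebra_simps)
      ultimately show False
        using disjoint height by (auto simp: disjoint_family_on_def)
    qed
    moreover have "x \<in> shift r L" using x top by simp
    ultimately show "x \<in> shift r (L - A) \<union> (shift r A - levels E {0..H})"
      by blast
  qed
  then have "measure M (shift (H + 1) E - E) \<le> measure M (shift r (L - A) \<union> (shift r A - levels E {0..H}))"
    using A A' L tower base_sets
    by (intro measure_mono_fmeasurable fmeasurable.Un fmeasurable_Diff sets.Diff shift_sets shift_fmeasurable)
  also have "\<dots> \<le> measure M (shift r (L - A)) + measure M (shift r A - levels E {0..H})"
    using A A' L tower by (intro measure_Un_le sets.Diff shift_sets)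
  also have "measure M (shift r (L - A)) = measure M (L - A)"
    using A' L by (intro measure_shift) auto
  also have "measure M (shift r A - levels E {0..H}) \<le> (\<Sum>r\<in>{1..k}. measure M (shift r A - levels E {0..H}))"
    using r by (intro member_le_sum) auto
  finally have escape: "measure M (shift (H + 1) E - E)
      \<le> measure M (L - A) + (\<Sum>r\<in>{1..k}. measure M (shift r A - levels E {0..H}))"
    by simp
  have "shift i (shift (H + 1) E - E) = shift (H + 1) L - L"
    by (simp add: L_def shift_Diff level_space base_space shift_shift algebra_simps)
  then have return: "measure M (shift (H + 1) L - L) = measure M (shift (H + 1) E - E)"
    using measure_shift[of "shift (H + 1) E - E" i] base_sets shift_sets by simp
  have "measure M E = measure M (shift (H + 1) L)"
    using L by (simp add: measure_shift)
  also have "\<dots> \<le> measure M (((shift (H + 1) L - L) \<union> shift (H + 1) (L - A)) \<union> ((L - A) \<union> (shift (H + 1) A \<inter> A)))"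
    using L A A' by (intro measure_mono_fmeasurable fmeasurable.Un fmeasurable.Int fmeasurable_Diff shift_fmeasurable shift_sets) auto
  also have "\<dots> \<le> measure M ((shift (H + 1) L - L) \<union> shift (H + 1) (L - A)) + measure M ((L - A) \<union> (shift (H + 1) A \<inter> A))"
    using L A' by (intro measure_Un_le sets.Un sets.Int sets.Diff shift_sets) auto
  also have "\<dots> \<le> (measure M (shift (H + 1) L - L) + measure M (shift (H + 1) (L - A)))
      + (measure M (L - A) + measure M (shift (H + 1) A \<inter> A))"
    using L A' by (intro add_mono measure_Un_le sets.Un sets.Int sets.Diff shift_sets) auto
  also have "measure M (shift (H + 1) (L - A)) = measure M (L - A)"
    using A' L by (intro measure_shift) auto
  finally have "measure M E \<le> ?bound"
    using return escape LI by simp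
  moreover have "card {i \<in> I. i + k \<notin> {0..H}} \<le> k"
  proof -
    have "card {i \<in> I. i + k \<notin> {0..H}} \<le> card {H - k + 1..H}"
      using I k by (intro card_mono) (auto simp: subset_iff)
    then show ?thesis using k by simp
  qed
  then have "real (card {i \<in> I. i + k \<notin> {0..H}}) \<le> k"
    by (metis of_int_of_nat_eq of_int_le_iff)
  ultimately show ?thesis
    using k by (subst mult.commute) (intro mult_mono, auto)
qed

context
  fixes \<nu> assumes \<nu>: "self_joining M T \<nu>"
begin

text \<open>
  By invariance the mass of \<open>T^i E \<times> T^l E\<close> depends on \<open>l - i\<close> only; the pairs of levels are then
  grouped by that difference.
\<close>

lemma joining_levels:
  assumes "I \<subseteq> {0..H}" "J \<subseteq> {0..H}"
  shows "measure \<nu> (levels E I \<times> levels E J)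
    = (\<Sum>k\<in>{-H..H}. measure \<nu> (E \<times> shift k E) * card {i \<in> I. i + k \<in> J})"
proof -
  let ?c = "\<lambda>k. measure \<nu> (E \<times> shift k E)"
  have fin: "finite I" "finite J" using assms finite_subset by auto
  have "levels E I \<times> levels E J = (\<Union>(i, l)\<in>I \<times> J. shift i E \<times> shift l E)"
    by auto
  also have "measure \<nu> \<dots> = (\<Sum>(i, l)\<in>I \<times> J. measure \<nu> (shift i E \<times> shift l E))"
  proof (subst measure_disjoint_UNION)
    show "disjoint_family_on (\<lambda>(i, l). shift i E \<times> shift l E) (I \<times> J)"
      using assms by (intro disjoint_Times disjoint_family_on_mono[OF _ disjoint])
  qed (use fin base base_sets in \<open>auto intro!: joining_fmeasurable[OF \<nu>] shift_sets sum.cong\<close>)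
  also have "\<dots> = (\<Sum>i\<in>I. \<Sum>l\<in>J. ?c (l - i))"
  proof -
    have "measure \<nu> (shift i E \<times> shift l E) = ?c (l - i)" for i l
      using emeasure_joining_shift[OF \<nu> base_sets shift_sets[OF base_sets], of i "l - i"]
      by (simp add: measure_def shift_shift[OF base_space])
    then show ?thesis by (simp add: sum.cartesian_product)
  qed
  also have "\<dots> = (\<Sum>i\<in>I. \<Sum>k\<in>{-H..H}. if i + k \<in> J then ?c k else 0)"
  proof (rule sum.cong[OF refl])
    fix i assume i: "i \<in> I"
    have "- H \<le> l - i \<and> l - i \<le> H" if "l \<in> J" for l
      using subsetD[OF assms(1) i] subsetD[OF assms(2) that] by auto
    then have "(\<Sum>l\<in>J. ?c (l - i)) = (\<Sum>k\<in>{k\<in>{-H..H}. i + k \<in> J}. ?c k)"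
      using assms i by (intro sum.reindex_bij_witness[of _ "\<lambda>k. i + k" "\<lambda>l. l - i"]) auto
    then show "(\<Sum>l\<in>J. ?c (l - i)) = (\<Sum>k\<in>{-H..H}. if i + k \<in> J then ?c k else 0)"
      by (simp only: sum.inter_filter finite_atLeastAtMost_int)
  qed
  also have "\<dots> = (\<Sum>k\<in>{-H..H}. \<Sum>i\<in>I. if i + k \<in> J then ?c k else 0)"
    by (rule sum.swap)
  also have "\<dots> = (\<Sum>k\<in>{-H..H}. ?c k * card {i \<in> I. i + k \<in> J})"
    using fin by (intro sum.cong refl) (simp flip: sum.inter_filter add: mult.commute)
  finally show ?thesis .
qed

text \<open>
  The sets \<open>T^k E\<close> for \<open>k\<close> in \<open>K\<close> are disjoint because some power of \<open>T\<close> moves all of them into the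
  tower. The range \<open>{-H..H}\<close> is too long for that, but it splits into two admissible ranges, whence
  the constant 2 in the bound on the total weight.
\<close>

lemma joining_column_sum_le:
  assumes "\<And>k. k \<in> K \<Longrightarrow> k + s \<in> {0..H}"
  shows "(\<Sum>k\<in>K. measure \<nu> (E \<times> shift k E)) \<le> measure M E"
proof -
  have "K \<subseteq> {-s..H - s}" using assms by force
  then have K: "finite K" using finite_subset by blast
  have "(\<Sum>k\<in>K. measure \<nu> (E \<times> shift k E)) = measure \<nu> (\<Union>k\<in>K. E \<times> shift k E)"
  proof (intro measure_disjoint_UNION[symmetric] joining_fmeasurable[OF \<nu>] shift_sets)
    have "disjoint_family_on (\<lambda>k. shift k E) K" using assms by (rule shift_disjoint)
    then show "disjoint_family_on (\<lambda>k. E \<times> shift k E) K"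
      unfolding disjoint_family_on_def by (simp only: Times_Int_Times Times_empty) blast
  qed (use K base base_sets in auto)
  also have "\<dots> \<le> measure \<nu> (E \<times> space M)"
    using K base base_sets level_space
    by (intro measure_mono_fmeasurable joining_fmeasurable[OF \<nu>] sets.finite_UN)
      (auto simp: joining_sets[OF \<nu>] intro!: shift_sets pair_measureI)
  also have "\<dots> = measure M E"
    using \<nu> base_sets by (simp add: self_joining_def measure_def)
  finally show ?thesis .
qed

lemma joining_weights_sum_le:
  "(\<Sum>k\<in>{-H..H}. measure \<nu> (E \<times> shift k E) / measure M E) \<le> 2"
proof -
  have "{-H..H} = {-H..-1} \<union> {0..H}" using height by auto
  then have "(\<Sum>k\<in>{-H..H}. measure \<nu> (E \<times> shift k E))
      = (\<Sum>k\<in>{-H..-1}. measure \<nu> (E \<times> shift k E)) + (\<Sum>k\<in>{0..H}. measure \<nu> (E \<times> shift k E))"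
    by (simp add: sum.union_disjoint)
  also have "\<dots> \<le> measure M E + measure M E"
    by (intro add_mono joining_column_sum_le[of _ H] joining_column_sum_le[of _ 0]) auto
  finally show ?thesis
    by (cases "measure M E = 0") (auto simp: divide_simps zero_less_measure_iff simp flip: sum_divide_distrib)
qed

end
end

section \<open>Approximation and mixing\<close>

context measure_automorphism
begin

definition approximated_by :: "'a set \<Rightarrow> (nat \<Rightarrow> 'a set) \<Rightarrow> bool" where
  "approximated_by A B \<longleftrightarrow> (\<forall>j. B j \<in> fmeasurable M) \<and>
     (\<lambda>j. measure M (A - B j)) \<longlonglongrightarrow> 0 \<and> (\<lambda>j. measure M (B j - A)) \<longlonglongrightarrow> 0"

lemma approximated_by_subseq:
  "approximated_by A B \<Longrightarrow> strict_mono r \<Longrightarrow> approximated_by A (\<lambda>j. B (r j))"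
  unfolding approximated_by_def
  using LIMSEQ_subseq_LIMSEQ[of "\<lambda>j. measure M (A - B j)" 0 r] LIMSEQ_subseq_LIMSEQ[of "\<lambda>j. measure M (B j - A)" 0 r]
  by (auto simp: o_def)

text \<open>
  Both quantities to which this is applied, \<open>\<mu>(T^k A \<inter> B)\<close> and \<open>\<nu>(A \<times> B)\<close>, change by at most the
  measure of what is removed from \<open>A\<close> and \<open>B\<close>.
\<close>

lemma approximated_by_tendsto:
  assumes "approximated_by A A'" "approximated_by B B'"
    and f: "\<And>C C' D D'. C \<in> fmeasurable M \<Longrightarrow> C' \<in> fmeasurable M \<Longrightarrow> D \<in> fmeasurable M \<Longrightarrow> D' \<in> fmeasurable M
      \<Longrightarrow> f C D \<le> f C' D' + measure M (C - C') + measure M (D - D')"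
    and AB: "A \<in> fmeasurable M" "B \<in> fmeasurable M"
  shows "(\<lambda>j. f (A' j) (B' j)) \<longlonglongrightarrow> f A B"
proof (rule tendsto_of_two_sided_bound)
  have A': "A' j \<in> fmeasurable M" and B': "B' j \<in> fmeasurable M" for j
    using assms(1,2) by (auto simp: approximated_by_def)
  show "f A B \<le> f (A' j) (B' j) + measure M (A - A' j) + measure M (B - B' j)" for j
    by (rule f[OF AB(1) A' AB(2) B'])
  show "f (A' j) (B' j) \<le> f A B + measure M (A' j - A) + measure M (B' j - B)" for j
    by (rule f[OF A' AB(1) B' AB(2)])
qed (use assms(1,2) in \<open>simp_all add: approximated_by_def\<close>)

lemma approximated_by_shift_Int:
  assumes "approximated_by A A'" "approximated_by B B'" "A \<in> fmeasurable M" "B \<in> fmeasurable M"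
  shows "(\<lambda>j. measure M (shift k (A' j) \<inter> B' j)) \<longlonglongrightarrow> measure M (shift k A \<inter> B)"
  by (rule approximated_by_tendsto[where f = "\<lambda>C D. measure M (shift k C \<inter> D)",
        OF assms(1,2) _ assms(3,4)]) (rule measure_shift_Int_le)

lemma approximated_by_joining:
  assumes "approximated_by A A'" "approximated_by B B'" and \<nu>: "self_joining M T \<nu>"
    and "A \<in> fmeasurable M" "B \<in> fmeasurable M"
  shows "(\<lambda>j. measure \<nu> (A' j \<times> B' j)) \<longlonglongrightarrow> measure \<nu> (A \<times> B)"
  by (rule approximated_by_tendsto[where f = "\<lambda>C D. measure \<nu> (C \<times> D)",
        OF assms(1,2) _ assms(4,5)]) (rule measure_joining_le[OF \<nu>])

lemma mixing_finite:
  assumes "mixing_infinite M T" "A \<in> fmeasurable M" "B \<in> fmeasurable M" "0 < \<epsilon>"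
  shows "finite {k. \<epsilon> < measure M (shift k A \<inter> B)}"
proof -
  have "(0 :: ennreal) < ennreal \<epsilon>" using assms by simp
  then obtain N where N: "\<And>k. \<bar>k\<bar> > N \<Longrightarrow> emeasure M (shift k A \<inter> B) < ennreal \<epsilon>"
    using assms(1)[unfolded mixing_infinite_def, rule_format, of "ennreal \<epsilon>" A B] assms(2,3)
    by (auto simp: fmeasurable_def)
  have "measure M (shift k A \<inter> B) \<le> \<epsilon>" if "\<bar>k\<bar> > N" for k
    using N[OF that] assms(4) by (simp add: measure_def enn2real_leI less_imp_le)
  then have "{k. \<epsilon> < measure M (shift k A \<inter> B)} \<subseteq> {-N..N}"
    by (force simp: not_less[symmetric])
  then show ?thesis using finite_subset by blast
qed

lemma mixing_tendsto:
  assumes "mixing_infinite M T" "A \<in> fmeasurable M" "B \<in> fmeasurable M"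
  shows "((\<lambda>k. measure M (shift k A \<inter> B)) \<longlongrightarrow> 0) at_top"
proof (rule tendstoI)
  fix e :: real assume e: "0 < e"
  then have "finite {k. e / 2 < measure M (shift k A \<inter> B)}"
    using assms by (intro mixing_finite) auto
  then obtain N where N: "\<And>k. e / 2 < measure M (shift k A \<inter> B) \<Longrightarrow> k \<le> N"
    using bdd_above_finite[of "{k. e / 2 < measure M (shift k A \<inter> B)}"] unfolding bdd_above_def by blast
  have "dist (measure M (shift k A \<inter> B)) 0 < e" if "N < k" for k
  proof -
    have "measure M (shift k A \<inter> B) \<le> e / 2"
      using N[of k] that by (meson not_le)
    then show ?thesis using e by (simp add: dist_real_def)
  qed
  then show "\<forall>\<^sub>F k in at_top. dist (measure M (shift k A \<inter> B)) 0 < e"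
    by (rule eventually_mono[OF eventually_gt_at_top[of N]])
qed

end

section \<open>Self-joinings in terms of towers\<close>

text \<open>
  This is the form in which rank one and the infinite measure are used. It passes to subsequences
  of towers, as the extraction of convergent weights demands.
\<close>

locale mixing_towers = measure_automorphism +
  fixes E :: "nat \<Rightarrow> 'a set" and H :: "nat \<Rightarrow> int"
  assumes mixing: "mixing_infinite M T"
    and tower: "\<And>j. tower M T (E j) (H j)"
    and heights: "filterlim H at_top sequentially"
    and approximation: "\<And>A. A \<in> fmeasurable M \<Longrightarrow>
      \<exists>I. (\<forall>j. I j \<subseteq> {0..H j}) \<and> approximated_by A (\<lambda>j. levels (E j) (I j))"
begin

lemma mixing_towers_subseq:
  assumes r: "strict_mono r"
  shows "mixing_towers M T (\<lambda>j. E (r j)) (\<lambda>j. H (r j))"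
proof (intro mixing_towers.intro mixing_towers_axioms.intro)
  show "measure_automorphism M T" by (rule measure_automorphism_axioms)
  show "mixing_infinite M T" by (rule mixing)
  show "tower M T (E (r j)) (H (r j))" for j by (rule tower)
  show "filterlim (\<lambda>j. H (r j)) at_top sequentially"
    using filterlim_compose[OF heights filterlim_subseq[OF r]] .
  fix A assume "A \<in> fmeasurable M"
  then obtain I where I: "\<forall>j. I j \<subseteq> {0..H j}" "approximated_by A (\<lambda>j. levels (E j) (I j))"
    using approximation by blast
  then show "\<exists>I. (\<forall>j. I j \<subseteq> {0..H (r j)}) \<and> approximated_by A (\<lambda>j. levels (E (r j)) (I j))"
    using approximated_by_subseq[OF I(2) r] by (intro exI[of _ "\<lambda>j. I (r j)"]) auto
qed

lemma outside_tower_tendsto: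
  assumes A: "A \<in> fmeasurable M"
  shows "(\<lambda>j. measure M (A - levels (E j) {0..H j})) \<longlonglongrightarrow> 0"
proof -
  obtain I where I: "\<And>j. I j \<subseteq> {0..H j}" "approximated_by A (\<lambda>j. levels (E j) (I j))"
    using approximation[OF A] by blast
  have "measure M (A - levels (E j) {0..H j}) \<le> measure M (A - levels (E j) (I j))" for j
    using I A tower.levels_fmeasurable[OF tower, of "{0..H j}" j]
    by (intro measure_mono_fmeasurable fmeasurable.Diff) (auto simp: approximated_by_def)
  moreover have "(\<lambda>j. measure M (A - levels (E j) (I j))) \<longlonglongrightarrow> 0"
    using I(2) by (simp add: approximated_by_def)
  ultimately show ?thesis
    by (rule tendsto_squeeze[where g = "\<lambda>_. 0", OF measure_nonneg _ tendsto_const])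
qed

lemma top_levels_tendsto:
  assumes A: "A \<in> fmeasurable M" and I: "\<And>j. I j \<subseteq> {0..H j}"
    and approx: "approximated_by A (\<lambda>j. levels (E j) (I j))" and k: "0 \<le> k"
  shows "(\<lambda>j. measure M (E j) * card {i \<in> I j. i + k \<notin> {0..H j}}) \<longlonglongrightarrow> 0"
proof -
  let ?u = "\<lambda>j. of_int k * (measure M (shift (H j + 1) A \<inter> A) + 3 * measure M (levels (E j) (I j) - A)
      + (\<Sum>r\<in>{1..k}. measure M (shift r A - levels (E j) {0..H j})))"
  have "filterlim (\<lambda>j. H j + 1) at_top sequentially"
    by (rule filterlim_at_top_mono[OF heights]) simp
  then have "(\<lambda>j. measure M (shift (H j + 1) A \<inter> A)) \<longlonglongrightarrow> 0"
    by (rule filterlim_compose[OF mixing_tendsto[OF mixing A A]])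
  then have "?u \<longlonglongrightarrow> of_int k * (0 + 3 * 0 + (\<Sum>r\<in>{1..k}. 0))"
    using approx A by (intro tendsto_intros outside_tower_tendsto shift_fmeasurable) (auto simp: approximated_by_def)
  then have u: "?u \<longlonglongrightarrow> 0"
    by simp
  have le: "measure M (E j) * card {i \<in> I j. i + k \<notin> {0..H j}} \<le> ?u j" for j
    by (rule tower.top_levels_le[OF tower A I k])
  have nonneg: "0 \<le> measure M (E j) * card {i \<in> I j. i + k \<notin> {0..H j}}" for j
    by (intro mult_nonneg_nonneg measure_nonneg of_nat_0_le_iff)
  show ?thesis
    by (rule tendsto_squeeze[where g = "\<lambda>_. 0", OF nonneg le tendsto_const u])
qed

lemma overlap_count_tendsto_nonneg:
  assumes A: "A \<in> fmeasurable M" and I: "\<And>j. I j \<subseteq> {0..H j}" "approximated_by A (\<lambda>j. levels (E j) (I j))"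
    and B: "B \<in> fmeasurable M" and J: "\<And>j. J j \<subseteq> {0..H j}" "approximated_by B (\<lambda>j. levels (E j) (J j))"
    and k: "0 \<le> k"
  shows "(\<lambda>j. measure M (E j) * card {i \<in> I j. i + k \<in> J j}) \<longlonglongrightarrow> measure M (shift k A \<inter> B)"
proof -
  let ?m = "\<lambda>j. measure M (shift k (levels (E j) (I j)) \<inter> levels (E j) (J j))"
  let ?e = "\<lambda>j. measure M (E j) * card {i \<in> I j. i + k \<notin> {0..H j}}"
  let ?w = "\<lambda>j. measure M (E j) * card {i \<in> I j. i + k \<in> J j}"
  have m: "?m \<longlonglongrightarrow> measure M (shift k A \<inter> B)"
    by (rule approximated_by_shift_Int[OF I(2) J(2) A B])
  have e: "?e \<longlonglongrightarrow> 0"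
    by (rule top_levels_tendsto[OF A I k])
  have me: "(\<lambda>j. ?m j - ?e j) \<longlonglongrightarrow> measure M (shift k A \<inter> B)"
    using tendsto_diff[OF m e] by (simp only: diff_zero)
  have le: "?m j \<le> ?w j + ?e j" for j
    by (rule tower.overlap_le[OF tower I(1) J(1)])
  have lower: "?m j - ?e j \<le> ?w j" for j
    using le[of j] by (simp only: diff_le_eq)
  have upper: "?w j \<le> ?m j" for j
    by (rule tower.overlap_ge[OF tower I(1) J(1)])
  show ?thesis
    by (rule tendsto_squeeze[OF lower upper me m])
qed

text \<open>
  For negative \<open>k\<close> it is the bottom of the tower that the levels leave. Exchanging the roles of \<open>A\<close>
  and \<open>B\<close> replaces \<open>k\<close> by \<open>-k\<close> and leaves both the count and the measure unchanged.
\<close>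

lemma overlap_count_tendsto:
  assumes A: "A \<in> fmeasurable M" and I: "\<And>j. I j \<subseteq> {0..H j}" "approximated_by A (\<lambda>j. levels (E j) (I j))"
    and B: "B \<in> fmeasurable M" and J: "\<And>j. J j \<subseteq> {0..H j}" "approximated_by B (\<lambda>j. levels (E j) (J j))"
  shows "(\<lambda>j. measure M (E j) * card {i \<in> I j. i + k \<in> J j}) \<longlonglongrightarrow> measure M (shift k A \<inter> B)"
proof (cases "0 \<le> k")
  case True
  then show ?thesis using overlap_count_tendsto_nonneg[OF A I B J] by blast
next
  case False
  then have "(\<lambda>j. measure M (E j) * card {i \<in> J j. i + - k \<in> I j}) \<longlonglongrightarrow> measure M (shift (- k) B \<inter> A)"
    by (intro overlap_count_tendsto_nonneg[OF B J A I]) auto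
  moreover have "card {i \<in> J j. i + - k \<in> I j} = card {i \<in> I j. i + k \<in> J j}" for j
    by (rule bij_betw_same_card[of "\<lambda>i. i - k"]) (auto intro!: bij_betwI[where g = "\<lambda>i. i + k"])
  moreover have "measure M (shift (- k) B \<inter> A) = measure M (shift k A \<inter> B)"
  proof -
    have "shift k (shift (- k) B \<inter> A) = B \<inter> shift k A"
      using shift_Int_shift[of B A 0 k] A B fmeasurable_space by auto
    then show ?thesis
      using measure_shift[of "shift (- k) B \<inter> A" k] A B shift_sets[of B "- k"] by (simp add: Int_commute fmeasurableD)
  qed
  ultimately show ?thesis by simp
qed

text \<open>
  The coefficients are limits of the normalised masses \<open>\<nu>(E \<times> T^k E) / \<mu>(E)\<close> along one subsequence
  of the towers that works for every \<open>k\<close>, and in particular they do not depend on \<open>A\<close> and \<open>B\<close>.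
\<close>

lemma joining_has_sum:
  assumes \<nu>: "self_joining M T \<nu>"
  shows "\<exists>c. (\<forall>k. 0 \<le> c k) \<and> (\<forall>A\<in>fmeasurable M. \<forall>B\<in>fmeasurable M.
    ((\<lambda>k. c k * measure M (shift k A \<inter> B)) has_sum measure \<nu> (A \<times> B)) UNIV)"
proof -
  define d where "d j k = (if k \<in> {- H j..H j} then measure \<nu> (E j \<times> shift k (E j)) / measure M (E j) else 0)" for j k
  have d_nonneg: "0 \<le> d j k" for j k by (simp add: d_def)
  have d_sum: "(\<Sum>k\<in>{- H j..H j}. d j k) \<le> 2" for j
    using tower.joining_weights_sum_le[OF tower \<nu>, of j] by (simp add: d_def)
  have d_le: "norm (d j k) \<le> 2" for j k
  proof (cases "k \<in> {- H j..H j}")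
    case True
    then have "d j k \<le> (\<Sum>k\<in>{- H j..H j}. d j k)" using d_nonneg by (intro member_le_sum) auto
    then show ?thesis using d_sum[of j] d_nonneg[of j k] by simp
  next
    case False
    then have "d j k = 0" unfolding d_def by (rule if_not_P)
    then show ?thesis by simp
  qed
  obtain r :: "nat \<Rightarrow> nat" where r: "strict_mono r" and "\<And>k. \<exists>l. (\<lambda>j. d (r j) k) \<longlonglongrightarrow> l"
    using function_convergent_subsequence[of UNIV d 2] d_le by auto
  then obtain c where c: "\<And>k. (\<lambda>j. d (r j) k) \<longlonglongrightarrow> c k" by metis
  interpret sub: mixing_towers M T "\<lambda>j. E (r j)" "\<lambda>j. H (r j)"
    using r by (rule mixing_towers_subseq)
  have "((\<lambda>k. c k * measure M (shift k A \<inter> B)) has_sum measure \<nu> (A \<times> B)) UNIV"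
    if A: "A \<in> fmeasurable M" and B: "B \<in> fmeasurable M" for A B
  proof -
    obtain I where I: "\<And>j. I j \<subseteq> {0..H (r j)}" "approximated_by A (\<lambda>j. levels (E (r j)) (I j))"
      using sub.approximation[OF A] by blast
    obtain J where J: "\<And>j. J j \<subseteq> {0..H (r j)}" "approximated_by B (\<lambda>j. levels (E (r j)) (J j))"
      using sub.approximation[OF B] by blast
    let ?A = "\<lambda>j. levels (E (r j)) (I j)" and ?B = "\<lambda>j. levels (E (r j)) (J j)"
    define w where "w j k = measure M (E (r j)) * card {i \<in> I j. i + k \<in> J j}" for j k
    have fm: "?A j \<in> fmeasurable M" "?B j \<in> fmeasurable M" for j
      using I(2) J(2) by (auto simp: approximated_by_def)
    show ?thesis
    proof (rule weighted_sum_limit)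
      show "w j k \<le> measure M (shift k A \<inter> B) + (measure M (?A j - A) + measure M (?B j - B))" for j k
      proof -
        have "w j k \<le> measure M (shift k (?A j) \<inter> ?B j)"
          unfolding w_def by (rule tower.overlap_ge[OF tower I(1) J(1)])
        also have "\<dots> \<le> measure M (shift k A \<inter> B) + measure M (?A j - A) + measure M (?B j - B)"
          by (rule measure_shift_Int_le[OF fm(1) A fm(2) B])
        finally show ?thesis by simp
      qed
      have "(\<lambda>j. measure M (?A j - A) + measure M (?B j - B)) \<longlonglongrightarrow> 0 + 0"
        using I(2) J(2) by (intro tendsto_add) (auto simp: approximated_by_def)
      then show "(\<lambda>j. measure M (?A j - A) + measure M (?B j - B)) \<longlonglongrightarrow> 0" by simp
      show "(\<lambda>j. w j k) \<longlonglongrightarrow> measure M (shift k A \<inter> B)" for k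
        unfolding w_def by (rule sub.overlap_count_tendsto[OF A I B J])
      show "finite {k. \<epsilon> < measure M (shift k A \<inter> B)}" if "0 < \<epsilon>" for \<epsilon>
        by (rule mixing_finite[OF mixing A B that])
      have "(\<Sum>k\<in>{- H (r j)..H (r j)}. d (r j) k * w j k) = measure \<nu> (?A j \<times> ?B j)" for j
      proof -
        \<comment> \<open>For a null base the quotient in \<open>d\<close> is 0 by convention, which is then the right value.\<close>
        have "measure \<nu> (E (r j) \<times> shift k (E (r j))) = 0"
          if "k \<in> {- H (r j)..H (r j)}" "measure M (E (r j)) = 0" for k
          using tower.joining_column_sum_le[OF tower \<nu>, of "{k}" "if 0 \<le> k then 0 else - k" "r j"] that
          by (auto intro!: antisym split: if_splits)
        then show ?thesis
          unfolding tower.joining_levels[OF tower \<nu> I(1) J(1)]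
          by (intro sum.cong refl) (auto simp: d_def w_def)
      qed
      then show "(\<lambda>j. \<Sum>k\<in>{- H (r j)..H (r j)}. d (r j) k * w j k) \<longlonglongrightarrow> measure \<nu> (A \<times> B)"
        using approximated_by_joining[OF I(2) J(2) \<nu> A B] by simp
    qed (use c d_nonneg d_sum in \<open>auto simp: d_def w_def\<close>)
  qed
  moreover have "0 \<le> c k" for k
    using c[of k] d_nonneg by (intro LIMSEQ_le_const) auto
  ultimately show ?thesis by blast
qed

end

section \<open>Good towers from rank one\<close>

context measure_automorphism
begin

lemma tower_partition_eq:
  "tower_partition M T E h = insert (space M - levels E {0..int h}) ((\<lambda>i. shift i E) ` {0..int h})"
proof -
  have img: "int ` {..h} = {0..int h}"
    using image_int_atLeastAtMost[of 0 h] by (simp add: atMost_atLeast0)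
  have "(\<Union>i\<le>h. (T ^^ i) ` E) = levels E {0..int h}"
    unfolding img[symmetric] by (simp add: iter_of_nat)
  moreover have "(\<lambda>i. (T ^^ i) ` E) ` {..h} = (\<lambda>i. shift i E) ` {0..int h}"
    unfolding img[symmetric] image_image iter_of_nat ..
  ultimately show ?thesis by (simp only: tower_partition_def)
qed

lemma cell_sets:
  assumes E: "E \<in> sets M" and C: "C \<in> tower_partition M T E h"
  shows "C \<in> sets M"
proof -
  have "levels E {0..int h} \<in> sets M"
    using shift_sets[OF E] by (intro sets.finite_UN) simp_all
  then have "space M - levels E {0..int h} \<in> sets M"
    by (rule sets.compl_sets)
  then show ?thesis
    using C shift_sets[OF E] unfolding tower_partition_eq by blast
qed

lemma cell_union_sets:
  assumes E: "E \<in> sets M" and S: "S \<subseteq> tower_partition M T E h"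
  shows "\<Union>S \<in> sets M"
proof (rule sets.finite_Union)
  have "finite (tower_partition M T E h)" unfolding tower_partition_eq by simp
  then show "finite S" by (rule finite_subset[OF S])
  show "S \<subseteq> sets M" using cell_sets[OF E] S by blast
qed

lemma cell_finite:
  assumes "E \<in> sets M" "S \<subseteq> tower_partition M T E h" "C \<in> S" "emeasure M (\<Union>S) < \<infinity>"
  shows "emeasure M C < \<infinity>"
  using emeasure_mono[OF Union_upper[OF assms(3)] cell_union_sets[OF assms(1,2)]] assms(4)
  by (rule le_less_trans)

text \<open>
  A cell of infinite measure cannot occur in a set of finite measure. For a base of finite measure
  that excludes the remainder cell, so only levels are left; for a base of infinite measure it
  excludes the levels, so only the remainder cell is left.
\<close>

lemma finite_union_of_levels:
  assumes "emeasure M (space M) = \<infinity>" and E: "E \<in> fmeasurable M"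
    and S: "S \<subseteq> tower_partition M T E h" "emeasure M (\<Union>S) < \<infinity>"
  shows "\<exists>I\<subseteq>{0..int h}. \<Union>S = levels E I"
proof -
  let ?R = "space M - levels E {0..int h}"
  have E': "E \<in> sets M" using E by auto
  have lev: "levels E {0..int h} \<in> fmeasurable M"
    using E by (intro fmeasurable_UNION shift_fmeasurable) auto
  have "emeasure M (space M) \<le> emeasure M (?R \<union> levels E {0..int h})"
    using lev by (intro emeasure_mono) auto
  also have "\<dots> \<le> emeasure M ?R + emeasure M (levels E {0..int h})"
    using lev by (intro emeasure_subadditive) auto
  finally have "emeasure M ?R = \<infinity>"
    using assms(1) lev by (auto simp: fmeasurable_def top_unique)
  then have "?R \<notin> S"
    using cell_finite[OF E' S(1) _ S(2)] by (metis less_irrefl)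
  then have "S \<subseteq> (\<lambda>i. shift i E) ` {0..int h}"
    using S(1) unfolding tower_partition_eq by blast
  then obtain I where I: "I \<subseteq> {0..int h}" "S = (\<lambda>i. shift i E) ` I"
    by (rule subset_imageE)
  show ?thesis
    by (rule exI[of _ I]) (simp add: I)
qed

lemma union_of_infinite_levels:
  assumes E: "E \<in> sets M" and inf: "emeasure M E = \<infinity>"
    and S: "S \<subseteq> tower_partition M T E h" "emeasure M (\<Union>S) < \<infinity>"
  shows "\<Union>S = {} \<or> \<Union>S = space M - levels E {0..int h}"
proof -
  have "C = space M - levels E {0..int h}" if C: "C \<in> S" for C
  proof (rule ccontr)
    assume "C \<noteq> space M - levels E {0..int h}"
    then obtain i where "C = shift i E"
      using C S(1) unfolding tower_partition_eq by blast
    then have "emeasure M C = \<infinity>" using inf E by (simp add: emeasure_shift)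
    then show False using cell_finite[OF E S(1) C S(2)] by simp
  qed
  then have "S \<subseteq> {space M - levels E {0..int h}}" by blast
  then have "S = {} \<or> S = {space M - levels E {0..int h}}" by (rule subset_singletonD)
  then show ?thesis by auto
qed

lemma sym_diff_finite:
  assumes "A \<in> fmeasurable M" "B \<in> sets M" "emeasure M ((A - B) \<union> (B - A)) < 1"
  shows "B \<in> fmeasurable M" "measure M A \<le> measure M B + 1" "measure M B \<le> measure M A + 1"
proof -
  have sd: "(A - B) \<union> (B - A) \<in> fmeasurable M"
    using assms(1,2) assms(3) less_trans[OF assms(3), of \<infinity>] by (intro fmeasurableI) auto
  show B: "B \<in> fmeasurable M"
    by (rule fmeasurableI2[OF fmeasurable.Un[OF assms(1) sd]]) (use assms in auto)
  have m: "measure M ((A - B) \<union> (B - A)) \<le> 1"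
    using assms(3) by (simp add: measure_def enn2real_leI less_imp_le)
  have "measure M A \<le> measure M (B \<union> ((A - B) \<union> (B - A)))"
    using assms(1) B sd by (intro measure_mono_fmeasurable fmeasurable.Un) auto
  also have "\<dots> \<le> measure M B + measure M ((A - B) \<union> (B - A))"
    using B sd by (intro measure_Un_le) auto
  finally show "measure M A \<le> measure M B + 1" using m by simp
  have "measure M B \<le> measure M (A \<union> ((A - B) \<union> (B - A)))"
    using assms(1) B sd by (intro measure_mono_fmeasurable fmeasurable.Un) auto
  also have "\<dots> \<le> measure M A + measure M ((A - B) \<union> (B - A))"
    using assms(1) sd by (intro measure_Un_le) auto
  finally show "measure M B \<le> measure M A + 1" using m by simp
qed

lemma ex_large_fmeasurable:
  assumes "sigma_finite_measure M" "emeasure M (space M) = \<infinity>" "0 \<le> C"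
  shows "\<exists>A\<in>fmeasurable M. C < measure M A"
proof -
  interpret sigma_finite_measure M by fact
  obtain Z where Z: "Z \<in> sets M" "Z \<subseteq> space M" "emeasure M Z < \<infinity>" "ennreal C < emeasure M Z"
    by (rule approx_PInf_emeasure_with_finite[OF sets.top assms(2)])
  then have fm: "Z \<in> fmeasurable M" by (intro fmeasurableI)
  then have "C < measure M Z"
    using Z(4) assms(3) by (simp add: emeasure_eq_measure2 ennreal_less_iff)
  then show ?thesis using fm by blast
qed

text \<open>
  Some set of positive measure is approximated by nonempty unions of levels, so \<open>\<mu>(E)\<close> is eventually
  bounded by a constant \<open>c\<close>. The tower also has to approximate sets of arbitrarily large measure,
  and with levels of measure at most \<open>c\<close> this takes many levels.
\<close>

lemma heights_unbounded:
  assumes "sigma_finite_measure M" and inf: "emeasure M (space M) = \<infinity>"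
    and tow: "\<And>j. tower M T (E j) (H j)"
    and approximation: "\<And>A. A \<in> fmeasurable M \<Longrightarrow>
      \<exists>I. (\<forall>j. I j \<subseteq> {0..H j}) \<and> approximated_by A (\<lambda>j. levels (E j) (I j))"
  shows "filterlim H at_top sequentially"
proof -
  note large = ex_large_fmeasurable[OF assms(1) inf]
  have near: "\<forall>\<^sub>F j in sequentially. measure M A < measure M (levels (E j) (I j)) + 1
      \<and> measure M (levels (E j) (I j)) < measure M A + 1"
    if A: "A \<in> fmeasurable M" and I: "approximated_by A (\<lambda>j. levels (E j) (I j))" for A I
  proof -
    have ev: "\<forall>\<^sub>F j in sequentially. measure M (A - levels (E j) (I j)) < 1"
      "\<forall>\<^sub>F j in sequentially. measure M (levels (E j) (I j) - A) < 1"
      using I by (auto simp: approximated_by_def intro: order_tendstoD)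
    have fm: "levels (E j) (I j) \<in> fmeasurable M" for j
      using I by (auto simp: approximated_by_def)
    have le: "measure M P \<le> measure M Q + measure M (P - Q)" if "P \<in> fmeasurable M" "Q \<in> fmeasurable M" for P Q
    proof -
      have "measure M P \<le> measure M (Q \<union> (P - Q))"
        using that by (intro measure_mono_fmeasurable fmeasurable.Un fmeasurable.Diff) auto
      also have "\<dots> \<le> measure M Q + measure M (P - Q)"
        using that by (intro measure_Un_le) auto
      finally show ?thesis .
    qed
    show ?thesis
      using ev
    proof eventually_elim
      case (elim j)
      then show ?case using le[OF A fm[of j]] le[OF fm[of j] A] by linarith
    qed
  qed
  obtain A\<^sub>1 where A1: "A\<^sub>1 \<in> fmeasurable M" "1 < measure M A\<^sub>1"
    using large[of 1] by auto
  obtain I\<^sub>1 where I1: "\<And>j. I\<^sub>1 j \<subseteq> {0..H j}" "approximated_by A\<^sub>1 (\<lambda>j. levels (E j) (I\<^sub>1 j))"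
    using approximation[OF A1(1)] by blast
  define c where "c = measure M A\<^sub>1 + 1"
  have base_le: "\<forall>\<^sub>F j in sequentially. measure M (E j) \<le> c"
    using near[OF A1(1) I1(2)]
  proof eventually_elim
    case (elim j)
    interpret tower M T "E j" "H j" by (rule tow)
    have eq: "measure M (levels (E j) (I\<^sub>1 j)) = card (I\<^sub>1 j) * measure M (E j)"
      by (rule measure_levels[OF I1(1)])
    then have "card (I\<^sub>1 j) \<noteq> 0" using elim A1(2) by (intro notI) simp
    then have "1 * measure M (E j) \<le> card (I\<^sub>1 j) * measure M (E j)"
      by (intro mult_right_mono) auto
    then show ?case using eq elim by (simp add: c_def)
  qed
  show ?thesis
    unfolding filterlim_at_top
  proof
    fix Z :: int
    define N where "N = max 0 Z"
    have c: "0 \<le> c" by (simp add: c_def)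
    obtain A where A: "A \<in> fmeasurable M" "(N + 1) * c + 1 < measure M A"
      using large[of "(N + 1) * c + 1"] c by (auto simp: N_def)
    obtain I where I: "\<And>j. I j \<subseteq> {0..H j}" "approximated_by A (\<lambda>j. levels (E j) (I j))"
      using approximation[OF A(1)] by blast
    show "\<forall>\<^sub>F j in sequentially. Z \<le> H j"
      using near[OF A(1) I(2)] base_le
    proof eventually_elim
      case (elim j)
      interpret tower M T "E j" "H j" by (rule tow)
      have "card (I j) \<le> card {0..H j}" using I(1) by (intro card_mono) auto
      then have "real (card (I j)) \<le> H j + 1" using height by simp
      then have "card (I j) * measure M (E j) \<le> (H j + 1) * c"
        using elim(2) height by (intro mult_mono) auto
      then have "(N + 1) * c < (H j + 1) * c"
        using elim(1) A(2) measure_levels[OF I(1)] by simp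
      then have "real_of_int (N + 1) < real_of_int (H j + 1)"
        using c by (rule mult_right_less_imp_less)
      then show "Z \<le> H j" by (simp add: N_def)
    qed
  qed
qed

text \<open>
  The definition of rank one admits bases of infinite measure. Such a base can occur only finitely
  often: then both \<open>A\<^sub>1\<close> and the much larger \<open>A\<^sub>2\<close> would be close to the one cell that can have
  finite measure. After dropping an initial segment of the sequence all bases have finite measure.
\<close>

lemma rank_one_mixing_towers:
  assumes sf: "sigma_finite_measure M" and inf: "emeasure M (space M) = \<infinity>"
    and mix: "mixing_infinite M T" and r1: "rank_one M T"
  shows "\<exists>E H. mixing_towers M T E H"
proof -
  obtain F :: "nat \<Rightarrow> 'a set" and h :: "nat \<Rightarrow> nat"
    where tow: "\<forall>j. F j \<in> sets M \<and> disjoint_family_on (\<lambda>i. (T ^^ i) ` F j) {..h j}"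
      and appr: "\<forall>A\<in>sets M. emeasure M A < \<infinity> \<longrightarrow>
         (\<exists>B. (\<forall>j. \<exists>S\<subseteq>tower_partition M T (F j) (h j). B j = \<Union>S) \<and>
             (\<lambda>j. emeasure M ((A - B j) \<union> (B j - A))) \<longlonglongrightarrow> 0)"
    using r1[unfolded rank_one_def] by (elim exE conjE) (rule that)
  have F: "F j \<in> sets M" and disj: "disjoint_family_on (\<lambda>i. (T ^^ i) ` F j) {..h j}" for j
    using tow by blast+
  have approx: "\<exists>B. (\<forall>j. \<exists>S\<subseteq>tower_partition M T (F j) (h j). B j = \<Union>S) \<and> (\<forall>j. B j \<in> sets M) \<and>
      (\<lambda>j. emeasure M ((A - B j) \<union> (B j - A))) \<longlonglongrightarrow> 0 \<and>
      (\<forall>\<^sub>F j in sequentially. emeasure M ((A - B j) \<union> (B j - A)) < 1)" if A: "A \<in> fmeasurable M" for A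
  proof -
    have "emeasure M A < \<infinity>"
      using A by (simp add: fmeasurable_def)
    then obtain B where B: "\<forall>j. \<exists>S\<subseteq>tower_partition M T (F j) (h j). B j = \<Union>S"
      "(\<lambda>j. emeasure M ((A - B j) \<union> (B j - A))) \<longlonglongrightarrow> 0"
      using bspec[OF appr fmeasurableD[OF A]] by (elim impE exE conjE) (assumption, rule that)
    have "B j \<in> sets M" for j
    proof -
      obtain S where "S \<subseteq> tower_partition M T (F j) (h j)" "B j = \<Union>S" using B(1) by blast
      then show ?thesis using cell_union_sets[OF F] by simp
    qed
    moreover have "\<forall>\<^sub>F j in sequentially. emeasure M ((A - B j) \<union> (B j - A)) < 1"
      by (rule order_tendstoD(2)[OF B(2)]) simp
    ultimately show ?thesis using B by (intro exI[of _ B] conjI allI) auto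
  qed
  obtain A\<^sub>1 where A1: "A\<^sub>1 \<in> fmeasurable M" "1 < measure M A\<^sub>1"
    using ex_large_fmeasurable[OF sf inf, of 1] by auto
  obtain A\<^sub>2 where A2: "A\<^sub>2 \<in> fmeasurable M" "measure M A\<^sub>1 + 2 < measure M A\<^sub>2"
    using ex_large_fmeasurable[OF sf inf, of "measure M A\<^sub>1 + 2"] by auto
  obtain B\<^sub>1 where B1: "\<forall>j. \<exists>S\<subseteq>tower_partition M T (F j) (h j). B\<^sub>1 j = \<Union>S" "\<forall>j. B\<^sub>1 j \<in> sets M"
      "\<forall>\<^sub>F j in sequentially. emeasure M ((A\<^sub>1 - B\<^sub>1 j) \<union> (B\<^sub>1 j - A\<^sub>1)) < 1"
    using approx[OF A1(1)] by (elim exE conjE) (rule that)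
  obtain B\<^sub>2 where B2: "\<forall>j. \<exists>S\<subseteq>tower_partition M T (F j) (h j). B\<^sub>2 j = \<Union>S" "\<forall>j. B\<^sub>2 j \<in> sets M"
      "\<forall>\<^sub>F j in sequentially. emeasure M ((A\<^sub>2 - B\<^sub>2 j) \<union> (B\<^sub>2 j - A\<^sub>2)) < 1"
    using approx[OF A2(1)] by (elim exE conjE) (rule that)
  have "\<forall>\<^sub>F j in sequentially. emeasure M (F j) < \<infinity>"
    using B1(3) B2(3)
  proof eventually_elim
    case (elim j)
    note sd1 = sym_diff_finite[OF A1(1) B1(2)[rule_format] elim(1)]
      and sd2 = sym_diff_finite[OF A2(1) B2(2)[rule_format] elim(2)]
    show ?case
    proof (rule ccontr)
      assume "\<not> emeasure M (F j) < \<infinity>"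
      then have F_inf: "emeasure M (F j) = \<infinity>" by (simp add: not_less top_unique)
      have "emeasure M (B\<^sub>1 j) < \<infinity>" "emeasure M (B\<^sub>2 j) < \<infinity>"
        using sd1(1) sd2(1) by (auto simp: fmeasurable_def)
      moreover obtain S\<^sub>1 where "S\<^sub>1 \<subseteq> tower_partition M T (F j) (h j)" "B\<^sub>1 j = \<Union>S\<^sub>1"
        using B1(1) by blast
      moreover obtain S\<^sub>2 where "S\<^sub>2 \<subseteq> tower_partition M T (F j) (h j)" "B\<^sub>2 j = \<Union>S\<^sub>2"
        using B2(1) by blast
      ultimately have "B\<^sub>1 j = {} \<or> B\<^sub>1 j = space M - levels (F j) {0..int (h j)}"
        "B\<^sub>2 j = {} \<or> B\<^sub>2 j = space M - levels (F j) {0..int (h j)}"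
        using union_of_infinite_levels[OF F F_inf] by simp_all
      moreover have "B\<^sub>1 j \<noteq> {}" using sd1(2) A1(2) by (intro notI) simp
      moreover have "B\<^sub>2 j \<noteq> {}" using sd2(2) A2(2) A1(2) by (intro notI) simp
      ultimately have "B\<^sub>1 j = B\<^sub>2 j" by simp
      then show False using sd1(3) sd2(2) A2(2) by simp
    qed
  qed
  then obtain j\<^sub>0 where j0: "\<And>j. j\<^sub>0 \<le> j \<Longrightarrow> emeasure M (F j) < \<infinity>"
    unfolding eventually_sequentially by blast
  define E where "E j = F (j + j\<^sub>0)" for j
  define H where "H j = int (h (j + j\<^sub>0))" for j
  have E_fm: "E j \<in> fmeasurable M" for j
    using F j0 by (auto simp: E_def intro: fmeasurableI)
  have tow: "tower M T (E j) (H j)" for j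
  proof (intro tower.intro tower_axioms.intro measure_automorphism_axioms E_fm)
    show "0 \<le> H j" by (simp add: H_def)
    show "disjoint_family_on (\<lambda>i. shift i (E j)) {0..H j}"
      unfolding disjoint_family_on_def
    proof (intro ballI impI)
      fix i l assume il: "i \<in> {0..H j}" "l \<in> {0..H j}" "i \<noteq> l"
      then have "(T ^^ nat i) ` E j \<inter> (T ^^ nat l) ` E j = {}"
        unfolding E_def by (intro disjoint_family_onD[OF disj]) (auto simp: H_def)
      then show "shift i (E j) \<inter> shift l (E j) = {}"
        using il by (simp add: int_iterate_def)
    qed
  qed
  have appr': "\<exists>I. (\<forall>j. I j \<subseteq> {0..H j}) \<and> approximated_by A (\<lambda>j. levels (E j) (I j))"
    if A: "A \<in> fmeasurable M" for A
  proof -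
    obtain B where B1: "\<forall>j. \<exists>S\<subseteq>tower_partition M T (F j) (h j). B j = \<Union>S" and B2: "\<forall>j. B j \<in> sets M" and B:
      "(\<lambda>j. emeasure M ((A - B j) \<union> (B j - A))) \<longlonglongrightarrow> 0"
      "\<forall>\<^sub>F j in sequentially. emeasure M ((A - B j) \<union> (B j - A)) < 1"
      using approx[OF A] by (elim exE conjE) (rule that)
    let ?sd = "\<lambda>j. (A - B (j + j\<^sub>0)) \<union> (B (j + j\<^sub>0) - A)"
    \<comment> \<open>At the finitely many stages where the approximation is still bad, any \<open>I\<close> will do.\<close>
    have "\<forall>j. \<exists>I. I \<subseteq> {0..H j} \<and> (emeasure M (?sd j) < 1 \<longrightarrow> B (j + j\<^sub>0) = levels (E j) I)"
    proof
      fix j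
      show "\<exists>I. I \<subseteq> {0..H j} \<and> (emeasure M (?sd j) < 1 \<longrightarrow> B (j + j\<^sub>0) = levels (E j) I)"
      proof (cases "emeasure M (?sd j) < 1")
        case True
        obtain S where S: "S \<subseteq> tower_partition M T (E j) (h (j + j\<^sub>0))" "B (j + j\<^sub>0) = \<Union>S"
          using B1 unfolding E_def by blast
        have "emeasure M (\<Union>S) < \<infinity>"
          using sym_diff_finite(1)[OF A B2[rule_format] True] unfolding S(2) by (simp add: fmeasurable_def)
        from finite_union_of_levels[OF inf E_fm S(1) this] obtain J
          where "J \<subseteq> {0..int (h (j + j\<^sub>0))}" "\<Union>S = levels (E j) J"
          by (elim exE conjE) (rule that)
        then show ?thesis
          unfolding H_def by (intro exI[of _ J] conjI impI) (simp_all only: S(2))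
      qed (auto intro: exI[of _ "{}"])
    qed
    from choice[OF this] obtain I where I_ex: "\<forall>j. I j \<subseteq> {0..H j} \<and> (emeasure M (?sd j) < 1 \<longrightarrow> B (j + j\<^sub>0) = levels (E j) (I j))"
      by (elim exE) (rule that)
    have I: "I j \<subseteq> {0..H j}" "emeasure M (?sd j) < 1 \<Longrightarrow> B (j + j\<^sub>0) = levels (E j) (I j)" for j
      by (rule conjunct1[OF spec[OF I_ex]]) (rule mp[OF conjunct2[OF spec[OF I_ex]]])
    have fm: "levels (E j) (I j) \<in> fmeasurable M" for j
      using I(1)[of j] finite_subset[of "I j" "{0..H j}"] by (intro fmeasurable_UNION shift_fmeasurable E_fm) auto
    have shifted: "(\<lambda>j. emeasure M (?sd j)) \<longlonglongrightarrow> 0"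
      using B(1) by (rule LIMSEQ_ignore_initial_segment)
    have "(\<lambda>j. measure M (?sd j)) \<longlonglongrightarrow> 0"
      using tendsto_enn2real[of "\<lambda>j. emeasure M (?sd j)" 0 sequentially] shifted by (simp add: measure_def o_def)
    moreover have small: "\<forall>\<^sub>F j in sequentially. emeasure M (?sd j) < 1"
      by (rule order_tendstoD(2)[OF shifted]) simp
    have "\<forall>\<^sub>F j in sequentially. measure M (A - levels (E j) (I j)) \<le> measure M (?sd j)
        \<and> measure M (levels (E j) (I j) - A) \<le> measure M (?sd j)"
      using small
    proof eventually_elim
      case (elim j)
      have "?sd j \<in> fmeasurable M"
        using sym_diff_finite(1)[OF A B2[rule_format] elim] A by (intro fmeasurable.Un fmeasurable.Diff)
      then show ?case
        using A B2[rule_format, of "j + j\<^sub>0"] unfolding I(2)[OF elim, symmetric]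
        by (intro conjI measure_mono_fmeasurable) auto
    qed
    then have "\<forall>\<^sub>F j in sequentially. measure M (A - levels (E j) (I j)) \<le> measure M (?sd j)"
      "\<forall>\<^sub>F j in sequentially. measure M (levels (E j) (I j) - A) \<le> measure M (?sd j)"
      by (auto elim: eventually_mono)
    ultimately have "(\<lambda>j. measure M (A - levels (E j) (I j))) \<longlonglongrightarrow> 0" "(\<lambda>j. measure M (levels (E j) (I j) - A)) \<longlonglongrightarrow> 0"
      using tendsto_sandwich[of "\<lambda>_. 0" "\<lambda>j. measure M (A - levels (E j) (I j))" sequentially "\<lambda>j. measure M (?sd j)" 0]
        tendsto_sandwich[of "\<lambda>_. 0" "\<lambda>j. measure M (levels (E j) (I j) - A)" sequentially "\<lambda>j. measure M (?sd j)" 0]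
      by simp_all
    then show ?thesis
      using I(1) fm by (intro exI[of _ I]) (simp add: approximated_by_def)
  qed
  have "mixing_towers M T E H"
    by (intro mixing_towers.intro mixing_towers_axioms.intro measure_automorphism_axioms mix tow appr'
        heights_unbounded[OF sf inf tow appr'])
  then show ?thesis by blast
qed

end

section \<open>Minimal self-joinings\<close>

lemma (in mixing_towers) joining_eq_mixture:
  assumes sf: "sigma_finite_measure M" and inf: "emeasure M (space M) = \<infinity>" and \<nu>: "self_joining M T \<nu>"
  shows "\<exists>c. (\<integral>\<^sup>+k. c k \<partial>count_space UNIV) = 1 \<and> \<nu> = mixture (M \<Otimes>\<^sub>M M) c (off_diagonal M T)"
proof -
  interpret sigma_finite_measure M by fact
  obtain c where c: "\<forall>k. 0 \<le> c k" and has: "\<forall>A\<in>fmeasurable M. \<forall>B\<in>fmeasurable M.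
      ((\<lambda>k. c k * measure M (shift k A \<inter> B)) has_sum measure \<nu> (A \<times> B)) UNIV"
    using joining_has_sum[OF \<nu>] by (elim exE conjE) (rule that)
  define \<eta> where "\<eta> = mixture (M \<Otimes>\<^sub>M M) (\<lambda>k. ennreal (c k)) (off_diagonal M T)"
  have \<eta>: "emeasure \<eta> C = (\<integral>\<^sup>+k. ennreal (c k) * emeasure (off_diagonal M T k) C \<partial>count_space UNIV)"
    if "C \<in> sets (M \<Otimes>\<^sub>M M)" for C
    unfolding \<eta>_def using that by (intro emeasure_mixture) (simp_all add: off_diagonal_def)
  have rect: "emeasure \<nu> (A \<times> B) = emeasure \<eta> (A \<times> B)" if A: "A \<in> fmeasurable M" and B: "B \<in> fmeasurable M" for A B
  proof -
    have fm: "shift k A \<inter> B \<in> fmeasurable M" for k using A B by (intro fmeasurable.Int shift_fmeasurable)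
    have "emeasure \<eta> (A \<times> B) = (\<integral>\<^sup>+k. ennreal (c k * measure M (shift k A \<inter> B)) \<partial>count_space UNIV)"
      using A B c fm by (subst \<eta>) (auto simp: emeasure_off_diagonal[OF automorphism] fmeasurableD ennreal_mult emeasure_eq_measure2)
    also have "\<dots> = ennreal (measure \<nu> (A \<times> B))"
      using has[rule_format, OF A B] c by (intro nn_integral_has_sum) auto
    also have "\<dots> = emeasure \<nu> (A \<times> B)"
      using joining_fmeasurable[OF \<nu>, of A B] A B by (simp add: emeasure_eq_measure2 fmeasurableD)
    finally show ?thesis ..
  qed
  \<comment> \<open>That the weights sum to 1 is obtained afterwards, by comparing a marginal on both sides.\<close>
  have eq: "\<nu> = \<eta>"
    using sf \<nu> _ rect by (rule self_joining_eqI) (simp add: \<eta>_def)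
  obtain A where A: "A \<in> fmeasurable M" "1 < measure M A"
    using ex_large_fmeasurable[OF sf inf, of 1] by auto
  have A': "A \<in> sets M" "emeasure M A \<noteq> 0" "emeasure M A \<noteq> \<infinity>"
    using A by (auto simp: measure_def fmeasurable_def)
  have "emeasure M A = emeasure \<eta> (A \<times> space M)"
    using \<nu> A' by (simp add: self_joining_def flip: eq)
  also have "\<dots> = (\<integral>\<^sup>+k. ennreal (c k) * emeasure M A \<partial>count_space UNIV)"
    using A' self_joining_off_diagonal by (subst \<eta>) (auto simp: self_joining_def)
  also have "\<dots> = (\<integral>\<^sup>+k. ennreal (c k) \<partial>count_space UNIV) * emeasure M A"
    by (simp add: nn_integral_multc)
  finally have "emeasure M A * (\<integral>\<^sup>+k. ennreal (c k) \<partial>count_space UNIV) = emeasure M A * 1"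
    by (simp add: mult.commute)
  then have "(\<integral>\<^sup>+k. ennreal (c k) \<partial>count_space UNIV) = 1"
    using A' by (simp only: ennreal_mult_cancel_left) (simp add: top_unique)
  then show ?thesis
    using eq unfolding \<eta>_def by blast
qed

theorem theorem1:
  fixes M :: "'a measure" and T :: "'a \<Rightarrow> 'a"
  assumes "lebesgue_space M"
    and "sigma_finite_measure M"
    and "emeasure M (space M) = \<infinity>"
    and "automorphism M T"
    and "mixing_infinite M T"
    and "rank_one M T"
  shows "minimal_self_joinings M T"
  unfolding minimal_self_joinings_def
proof (intro allI impI)
  fix \<nu> assume \<nu>: "ergodic_self_joining M T \<nu>"
  interpret measure_automorphism M T by (rule measure_automorphism.intro) fact
  obtain E H where "mixing_towers M T E H"
    using rank_one_mixing_towers assms by blast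
  then interpret mixing_towers M T E H .
  have "self_joining M T \<nu>" using \<nu> by (simp add: ergodic_self_joining_def)
  then obtain c where "(\<integral>\<^sup>+k. c k \<partial>count_space UNIV) = 1" "\<nu> = mixture (M \<Otimes>\<^sub>M M) c (off_diagonal M T)"
    using joining_eq_mixture assms by blast
  then show "\<exists>k. \<nu> = off_diagonal M T k"
    by (rule extremal_mixture_eq_off_diagonal[OF \<nu>])
qed

end
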